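(* Let $W$ be a Weyl group, $g\ge0$ and $k\ge1$ integers, with $k\ge3$ if $g=0$. For the surface $\Sigma_{g,k}$ of genus $g$ with $k$ punctures (and no boundary), the invariant $P_{g,k,W}$ is a (Laurent) polynomial in $q=v^{-2}$ which is invariant under the transformation $q\mapsto q^{-1}$.
   Context: Let $(W,S)$ be the Coxeter system of a (finite) Weyl group. $\mathcal H$ is the unital $\mathbb Z[v^{\pm1}]$-algebra generated by $h_s$ ($s\in S$) with relations $h_s^2=(v^{-1}-v)h_s+1$ and braid relations $h_sh_th_s\cdots=h_th_sh_t\cdots$ ($m_{st}$ factors on each side, $m_{st}$ the order of $st$). For a reduced expression $w=s_1\cdots s_k$ put $h_w=h_{s_1}\cdots h_{s_k}$; $\{h_w\}_{w\in W}$ is a basis. Define $c_{xyz}\in\mathbb Z[v^{\pm1}]$ by $h_xh_y=\sum_zc_{xyz}h_{z^{-1}}$ (cyclically symmetric). Let $\mathsf T$ be a triangulation of $\Sigma_{g,k}$ with vertices at the punctures (an ideal triangulation; sides of a triangle may be glued together). Orient its edges. Define $P_{g,k,W}(v)=\sum\prod_fc_f(v)$, where the sum runs over all labelings of the edges by elements of $W$, the product over the faces $f$, and $c_f=c_{xyz}$ if $x,y,z$ are the labels of the sides of $f$ in cyclic order, where a label $w$ is replaced by $w^{-1}$ whenever the orientation of the edge is opposite to the one induced by $f$. This is independent of $\mathsf T$ and of the edge orientations. *)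

theory Defs
  imports "HOL-Analysis.Analysis" "HOL-Library.Poly_Mapping" "HOL-Library.FuncSet"
begin

section \<open>Weyl groups\<close>

definition reflection :: "'a::euclidean_space \<Rightarrow> 'a \<Rightarrow> 'a" where
  "reflection \<alpha> x = x - (2 * (x \<bullet> \<alpha>) / (\<alpha> \<bullet> \<alpha>)) *\<^sub>R \<alpha>"

text \<open>Reduced crystallographic root systems. The roots are not required to span the ambient
  space (so the empty root system, with trivial Weyl group, is included).\<close>

definition root_system :: "'a::euclidean_space set \<Rightarrow> bool" where
  "root_system \<Phi> \<longleftrightarrow>
     finite \<Phi> \<and> 0 \<notin> \<Phi> \<and>
     (\<forall>\<alpha>\<in>\<Phi>. reflection \<alpha> ` \<Phi> = \<Phi>) \<and>
     (\<forall>\<alpha>\<in>\<Phi>. \<forall>r. r *\<^sub>R \<alpha> \<in> \<Phi> \<longrightarrow> r = 1 \<or> r = -1) \<and>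
     (\<forall>\<alpha>\<in>\<Phi>. \<forall>\<beta>\<in>\<Phi>. 2 * (\<beta> \<bullet> \<alpha>) / (\<alpha> \<bullet> \<alpha>) \<in> \<int>)"

definition root_base :: "'a::euclidean_space set \<Rightarrow> 'a set \<Rightarrow> bool" where
  "root_base \<Phi> \<Delta> \<longleftrightarrow>
     \<Delta> \<subseteq> \<Phi> \<and> independent \<Delta> \<and>
     (\<forall>\<alpha>\<in>\<Phi>. \<exists>c :: 'a \<Rightarrow> nat.
        \<alpha> = (\<Sum>\<delta>\<in>\<Delta>. real (c \<delta>) *\<^sub>R \<delta>) \<or> \<alpha> = - (\<Sum>\<delta>\<in>\<Delta>. real (c \<delta>) *\<^sub>R \<delta>))"

text \<open>The group generated by all reflections in roots; closure under inverses is automatic, since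
  reflections are involutions.\<close>

inductive_set weyl_group :: "'a::euclidean_space set \<Rightarrow> ('a \<Rightarrow> 'a) set" for \<Phi> where
  id: "id \<in> weyl_group \<Phi>"
| comp: "\<alpha> \<in> \<Phi> \<Longrightarrow> w \<in> weyl_group \<Phi> \<Longrightarrow> reflection \<alpha> \<circ> w \<in> weyl_group \<Phi>"

definition simple_reflections :: "'a::euclidean_space set \<Rightarrow> ('a \<Rightarrow> 'a) set" where
  "simple_reflections \<Delta> = reflection ` \<Delta>"


section \<open>Expressions in a group of transformations\<close>

definition word_prod :: "('a \<Rightarrow> 'a) list \<Rightarrow> 'a \<Rightarrow> 'a" where
  "word_prod u = foldr (\<circ>) u id"

definition reduced_expression :: "('a \<Rightarrow> 'a) set \<Rightarrow> ('a \<Rightarrow> 'a) list \<Rightarrow> ('a \<Rightarrow> 'a) \<Rightarrow> bool" where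
  "reduced_expression S u w \<longleftrightarrow>
     set u \<subseteq> S \<and> word_prod u = w \<and>
     (\<forall>u'. set u' \<subseteq> S \<and> word_prod u' = w \<longrightarrow> length u \<le> length u')"

definition transformation_order :: "('a \<Rightarrow> 'a) \<Rightarrow> nat" where
  "transformation_order w = (LEAST n. 0 < n \<and> w ^^ n = id)"

fun alternating :: "nat \<Rightarrow> 'b \<Rightarrow> 'b \<Rightarrow> 'b list" where
  "alternating 0 s t = []"
| "alternating (Suc n) s t = s # alternating n t s"


section \<open>Laurent polynomials\<close>

text \<open>The ring of integral Laurent polynomials in one variable, as the group ring of the integers:
  \<open>Poly_Mapping.single n a\<close> is the monomial with exponent \<open>n\<close> and coefficient \<open>a\<close>.\<close>

type_synonym laurent = "int \<Rightarrow>\<^sub>0 int"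

definition laurent_var :: laurent where
  "laurent_var = Poly_Mapping.single 1 1"

definition laurent_var_inv :: laurent where
  "laurent_var_inv = Poly_Mapping.single (-1) 1"

text \<open>Substitution of the \<open>m\<close>-th power of the variable for the variable.\<close>

definition laurent_subst :: "int \<Rightarrow> laurent \<Rightarrow> laurent" where
  "laurent_subst m p =
     (\<Sum>n\<in>Poly_Mapping.keys p. Poly_Mapping.single (m * n) (Poly_Mapping.lookup p n))"


section \<open>The Hecke algebra\<close>

text \<open>The free monoid, written additively: the product of \<open>_ \<Rightarrow>\<^sub>0 _\<close> is the convolution with respect
  to addition of the indices, so that \<open>'b free_monoid \<Rightarrow>\<^sub>0 laurent\<close> is the free
  (noncommutative, associative, unital) algebra on \<open>'b\<close>.\<close>

datatype 'b free_monoid = Word (letters: "'b list")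

instantiation free_monoid :: (type) monoid_add
begin

definition zero_free_monoid :: "'a free_monoid" where
  "0 = Word []"

definition plus_free_monoid :: "'a free_monoid \<Rightarrow> 'a free_monoid \<Rightarrow> 'a free_monoid" where
  "a + b = Word (letters a @ letters b)"

instance
  by standard (simp_all add: zero_free_monoid_def plus_free_monoid_def)

end

type_synonym 'b free_algebra = "'b free_monoid \<Rightarrow>\<^sub>0 laurent"

definition scalar :: "laurent \<Rightarrow> 'b free_algebra" where
  "scalar a = Poly_Mapping.single 0 a"

definition word_monomial :: "'b list \<Rightarrow> 'b free_algebra" where
  "word_monomial u = Poly_Mapping.single (Word u) 1"

definition free_algebra_on :: "'b set \<Rightarrow> 'b free_algebra set" where
  "free_algebra_on S = {p. \<forall>u\<in>Poly_Mapping.keys p. set (letters u) \<subseteq> S}"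

definition hecke_relators :: "('a \<Rightarrow> 'a) set \<Rightarrow> ('a \<Rightarrow> 'a) free_algebra set" where
  "hecke_relators S =
     {word_monomial [s] * word_monomial [s]
        - (scalar (laurent_var_inv - laurent_var) * word_monomial [s] + 1) | s. s \<in> S} \<union>
     {word_monomial (alternating (transformation_order (s \<circ> t)) s t)
        - word_monomial (alternating (transformation_order (s \<circ> t)) t s)
      | s t. s \<in> S \<and> t \<in> S \<and> s \<noteq> t}"

text \<open>The two-sided ideal of the free algebra on \<open>S\<close> generated by the relators.\<close>

inductive_set hecke_ideal :: "('a \<Rightarrow> 'a) set \<Rightarrow> ('a \<Rightarrow> 'a) free_algebra set" for S where
  zero: "0 \<in> hecke_ideal S"
| add: "x \<in> hecke_ideal S \<Longrightarrow> p \<in> free_algebra_on S \<Longrightarrow> r \<in> hecke_relators S \<Longrightarrow>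
        q \<in> free_algebra_on S \<Longrightarrow> x + p * r * q \<in> hecke_ideal S"

text \<open>The Hecke algebra is the quotient of \<open>free_algebra_on S\<close> by \<open>hecke_ideal S\<close>. Its elements are
  handled through representatives, with the following congruence as equality.\<close>

definition hecke_eq ::
  "('a \<Rightarrow> 'a) set \<Rightarrow> ('a \<Rightarrow> 'a) free_algebra \<Rightarrow> ('a \<Rightarrow> 'a) free_algebra \<Rightarrow> bool" where
  "hecke_eq S p q \<longleftrightarrow> p - q \<in> hecke_ideal S"

text \<open>By Matsumoto's theorem the class of \<open>hecke_basis S w\<close> in the Hecke algebra of a Coxeter system
  does not depend on the chosen reduced expression.\<close>

definition hecke_basis :: "('a \<Rightarrow> 'a) set \<Rightarrow> ('a \<Rightarrow> 'a) \<Rightarrow> ('a \<Rightarrow> 'a) free_algebra" where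
  "hecke_basis S w = word_monomial (SOME u. reduced_expression S u w)"

text \<open>The coefficients of \<open>h\<^sub>x h\<^sub>y\<close> in the basis \<open>h\<^sub>w\<close>, where the index \<open>z\<close> refers to the basis element
  of the inverse of \<open>z\<close>. Unique existence holds because the \<open>h\<^sub>w\<close> form a basis; the support condition
  only fixes the values at functions outside \<open>W\<close>.\<close>

definition structure_constant ::
  "('a \<Rightarrow> 'a) set \<Rightarrow> ('a \<Rightarrow> 'a) set \<Rightarrow> ('a \<Rightarrow> 'a) \<Rightarrow> ('a \<Rightarrow> 'a) \<Rightarrow> ('a \<Rightarrow> 'a) \<Rightarrow> laurent" where
  "structure_constant W S x y =
     (THE c. (\<forall>z. z \<notin> W \<longrightarrow> c z = 0) \<and>
        hecke_eq S (hecke_basis S x * hecke_basis S y)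
          (\<Sum>z\<in>W. scalar (c z) * hecke_basis S (inv z)))"


section \<open>Ideal triangulations of punctured surfaces\<close>

text \<open>A triangulation is presented by its set \<open>F\<close> of (oriented) triangles and the pairing \<open>glue\<close> of
  their sides. The sides of \<open>f\<close> are \<open>(f, 0)\<close>, \<open>(f, 1)\<close>, \<open>(f, 2)\<close>, in the cyclic order given by the
  orientation of \<open>f\<close>; paired sides are glued reversing the orientations induced by their triangles,
  so that the resulting closed surface is oriented. Two sides of the same triangle may be paired.\<close>

definition sides :: "'f set \<Rightarrow> ('f \<times> nat) set" where
  "sides F = F \<times> {..<3}"

definition side_edge :: "('f \<times> nat \<Rightarrow> 'f \<times> nat) \<Rightarrow> 'f \<times> nat \<Rightarrow> ('f \<times> nat) set" where
  "side_edge glue s = {s, glue s}"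

definition edges :: "'f set \<Rightarrow> ('f \<times> nat \<Rightarrow> 'f \<times> nat) \<Rightarrow> ('f \<times> nat) set set" where
  "edges F glue = side_edge glue ` sides F"

text \<open>Corners are also indexed by \<open>sides F\<close>: \<open>(f, i)\<close> is the corner of \<open>f\<close> from which the side
  \<open>(f, i)\<close> starts, and that side ends at \<open>(f, (i + 1) mod 3)\<close>. Gluing identifies the start of a side
  with the end of the side paired with it, and vertices are the classes of corners for the
  equivalence relation generated by these identifications.\<close>

definition side_end :: "'f \<times> nat \<Rightarrow> 'f \<times> nat" where
  "side_end s = (fst s, Suc (snd s) mod 3)"

definition corner_identification :: "'f set \<Rightarrow> ('f \<times> nat \<Rightarrow> 'f \<times> nat) \<Rightarrow> (('f \<times> nat) \<times> ('f \<times> nat)) set"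
  where "corner_identification F glue = {(s, side_end (glue s)) | s. s \<in> sides F}"

definition vertices :: "'f set \<Rightarrow> ('f \<times> nat \<Rightarrow> 'f \<times> nat) \<Rightarrow> ('f \<times> nat) set set" where
  "vertices F glue =
     sides F // (corner_identification F glue \<union> (corner_identification F glue)\<inverse>)\<^sup>*"

text \<open>The glued surface is closed, connected and oriented. It is the surface of genus \<open>g\<close>, punctured
  at the \<open>k\<close> vertices, iff there are \<open>k\<close> vertices and the Euler characteristic of the closed surface
  is \<open>2 - 2 * g\<close>.\<close>

definition ideal_triangulation ::
  "nat \<Rightarrow> nat \<Rightarrow> 'f set \<Rightarrow> ('f \<times> nat \<Rightarrow> 'f \<times> nat) \<Rightarrow> bool" where
  "ideal_triangulation g k F glue \<longleftrightarrow>
     finite F \<and>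
     (\<forall>s\<in>sides F. glue s \<in> sides F \<and> glue s \<noteq> s \<and> glue (glue s) = s) \<and>
     (\<forall>f\<in>F. \<forall>f'\<in>F. (f, f') \<in> {(fst s, fst (glue s)) | s. s \<in> sides F}\<^sup>*) \<and>
     card (vertices F glue) = k \<and>
     int (card (vertices F glue)) - int (card (edges F glue)) + int (card F) = 2 - 2 * int g"

text \<open>An orientation of the edges selects, for each edge, the one of its two sides that induces the
  orientation of the edge.\<close>

definition edge_orientation ::
  "'f set \<Rightarrow> ('f \<times> nat \<Rightarrow> 'f \<times> nat) \<Rightarrow> (('f \<times> nat) set \<Rightarrow> 'f \<times> nat) \<Rightarrow> bool" where
  "edge_orientation F glue ori \<longleftrightarrow> (\<forall>e\<in>edges F glue. ori e \<in> e)"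

definition side_label ::
  "('f \<times> nat \<Rightarrow> 'f \<times> nat) \<Rightarrow> (('f \<times> nat) set \<Rightarrow> 'f \<times> nat) \<Rightarrow> (('f \<times> nat) set \<Rightarrow> 'a \<Rightarrow> 'a) \<Rightarrow>
   'f \<times> nat \<Rightarrow> 'a \<Rightarrow> 'a" where
  "side_label glue ori l s =
     (if ori (side_edge glue s) = s then l (side_edge glue s) else inv (l (side_edge glue s)))"

definition surface_invariant ::
  "('a \<Rightarrow> 'a) set \<Rightarrow> ('a \<Rightarrow> 'a) set \<Rightarrow> 'f set \<Rightarrow> ('f \<times> nat \<Rightarrow> 'f \<times> nat) \<Rightarrow>
   (('f \<times> nat) set \<Rightarrow> 'f \<times> nat) \<Rightarrow> laurent" where
  "surface_invariant W S F glue ori =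
     (\<Sum>l \<in> edges F glue \<rightarrow>\<^sub>E W. \<Prod>f\<in>F.
        structure_constant W S (side_label glue ori l (f, 0))
          (side_label glue ori l (f, 1)) (side_label glue ori l (f, 2)))"

end

theory Submission
  imports Defs
begin

text \<open>The relations of the Hecke algebra involve \<open>v\<close> only through \<open>\<zeta> = v\<^sup>-\<^sup>1 - v\<close>, so every structure constant is
an integral polynomial in \<open>\<zeta>\<close>. If \<open>h\<^sub>s\<close> and \<open>\<zeta>\<close> are both given odd degree, then the relation
\<open>h\<^sub>s\<^sup>2 = \<zeta> h\<^sub>s + 1\<close> is homogeneous modulo \<open>2\<close>, and so are the braid relations; hence only powers of \<open>\<zeta>\<close> whose
exponent has the parity of \<open>\<ell>(x) + \<ell>(y) + \<ell>(z)\<close> occur in \<open>c\<^sub>x\<^sub>y\<^sub>z\<close> (\<open>structure_constant_parity\<close>).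
In a summand of the surface invariant the label of each edge occurs on two sides of triangles, up to
inversion, which does not change the length. So the total degree of each summand is even
(\<open>even_sum_involution\<close>), and the invariant is a polynomial in
\<open>\<zeta>\<^sup>2 = v\<^sup>-\<^sup>2 - 2 + v\<^sup>2 = q + q\<^sup>-\<^sup>1 - 2\<close>, which is symmetric under \<open>q \<mapsto> q\<^sup>-\<^sup>1\<close>.\<close>

text \<open>The work lies in identifying the structure constants, which are defined by a definite description:
the elements \<open>h\<^sub>w\<close> have to form a basis of the quotient of the free algebra. They span because
\<open>h\<^sub>s h\<^sub>w\<close> is \<open>h\<^sub>s\<^sub>w\<close> or \<open>h\<^sub>s\<^sub>w + \<zeta> h\<^sub>w\<close>, which needs that all reduced expressions of an element are
related by braid moves (\<open>matsumoto\<close>). They are independent because the free algebra acts on the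
functions on \<open>W\<close> by the operators that these formulas suggest (\<open>left_mult\<close>), the relators act as
zero, and \<open>h\<^sub>w\<close> sends the indicator of the identity to that of \<open>w\<close> (\<open>hecke_basis_independent\<close>).
Everything about \<open>W\<close> that enters here follows from the exchange condition, which for a Weyl group
comes from the action on positive roots (\<open>strong_exchange\<close>).\<close>

section \<open>Words and their products\<close>

lemma word_prod_Nil [simp]: "word_prod [] = id"
  by (simp add: word_prod_def)

lemma word_prod_Cons [simp]: "word_prod (s # u) = s \<circ> word_prod u"
  by (simp add: word_prod_def)

lemma word_prod_append [simp]: "word_prod (u @ v) = word_prod u \<circ> word_prod v"
  by (induction u) (simp_all add: comp_assoc)

lemma word_prod_rev_involutions:
  assumes "\<And>s. s \<in> S \<Longrightarrow> s \<circ> s = id"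
  shows "set u \<subseteq> S \<Longrightarrow> word_prod u \<circ> word_prod (rev u) = id"
proof (induction u)
  case (Cons s u)
  have "word_prod (s # u) \<circ> word_prod (rev (s # u)) =
      s \<circ> (word_prod u \<circ> word_prod (rev u)) \<circ> s"
    by (simp add: comp_assoc)
  also have "\<dots> = s \<circ> s"
    using Cons by (metis comp_id list.set_intros(2) set_subset_Cons subset_trans)
  finally show ?case using Cons.prems assms[of s] by (metis list.set_intros(1) subsetD)
qed simp

definition expressible :: "('a \<Rightarrow> 'a) set \<Rightarrow> ('a \<Rightarrow> 'a) set" where
  "expressible S = {word_prod u | u. set u \<subseteq> S}"

definition expression_length :: "('a \<Rightarrow> 'a) set \<Rightarrow> ('a \<Rightarrow> 'a) \<Rightarrow> nat" where
  "expression_length S w = (LEAST n. \<exists>u. set u \<subseteq> S \<and> word_prod u = w \<and> length u = n)"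

lemma expressible_word_prod [intro, simp]: "set u \<subseteq> S \<Longrightarrow> word_prod u \<in> expressible S"
  by (auto simp: expressible_def)

lemma expression_length_le: "set u \<subseteq> S \<Longrightarrow> expression_length S (word_prod u) \<le> length u"
  unfolding expression_length_def by (rule Least_le) auto

lemma reduced_expression_iff:
  "reduced_expression S u w \<longleftrightarrow>
     set u \<subseteq> S \<and> word_prod u = w \<and> length u = expression_length S w"
proof
  assume r: "reduced_expression S u w"
  then have "expression_length S w = length u"
    unfolding expression_length_def reduced_expression_def by (intro Least_equality) auto
  then show "set u \<subseteq> S \<and> word_prod u = w \<and> length u = expression_length S w"
    using r by (simp add: reduced_expression_def)
next
  assume "set u \<subseteq> S \<and> word_prod u = w \<and> length u = expression_length S w"
  then show "reduced_expression S u w"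
    unfolding reduced_expression_def using expression_length_le by metis
qed

lemma ex_reduced_expression:
  assumes "w \<in> expressible S"
  shows "\<exists>u. reduced_expression S u w"
proof -
  have "\<exists>n u. set u \<subseteq> S \<and> word_prod u = w \<and> length u = n"
    using assms by (auto simp: expressible_def)
  from LeastI_ex[OF this] show ?thesis
    unfolding reduced_expression_iff expression_length_def by metis
qed

lemma set_alternating: "set (alternating n s t) \<subseteq> {s, t}"
  by (induction n arbitrary: s t) auto

lemma length_alternating [simp]: "length (alternating n s t) = n"
  by (induction n arbitrary: s t) auto

section \<open>Groups with the exchange condition\<close>

definition braid_move :: "('a \<Rightarrow> 'a) set \<Rightarrow> ('a \<Rightarrow> 'a) list \<Rightarrow> ('a \<Rightarrow> 'a) list \<Rightarrow> bool" where
  "braid_move S u u' \<longleftrightarrow> (\<exists>a b s t. set a \<subseteq> S \<and> set b \<subseteq> S \<and> s \<in> S \<and> t \<in> S \<and> s \<noteq> t \<and>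
     u = a @ alternating (transformation_order (s \<circ> t)) s t @ b \<and>
     u' = a @ alternating (transformation_order (s \<circ> t)) t s @ b)"

lemma braid_moves_Cons:
  assumes "(braid_move S)\<^sup>*\<^sup>* u u'" "s \<in> S"
  shows "(braid_move S)\<^sup>*\<^sup>* (s # u) (s # u')"
  using assms(1)
proof (induction rule: rtranclp_induct)
  case (step y z)
  then obtain a b p q where "set a \<subseteq> S" "set b \<subseteq> S" "p \<in> S" "q \<in> S" "p \<noteq> q"
    "y = a @ alternating (transformation_order (p \<circ> q)) p q @ b"
    "z = a @ alternating (transformation_order (p \<circ> q)) q p @ b"
    unfolding braid_move_def by blast
  then have "braid_move S (s # y) (s # z)"
    unfolding braid_move_def using assms(2)
    by (intro exI[of _ "s # a"] exI[of _ b] exI[of _ p] exI[of _ q]) auto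
  with step show ?case by (meson rtranclp.rtrancl_into_rtrancl)
qed auto

text \<open>A finite group of transformations generated by involutions that satisfies the exchange condition.
The condition is required for arbitrary words, and already if the length fails to increase; so
lengths of \<open>w\<close> and \<open>s \<circ> w\<close> being equal is excluded without recourse to a sign character.\<close>

locale coxeter_group =
  fixes S :: "('a \<Rightarrow> 'a) set"
  assumes involution: "s \<in> S \<Longrightarrow> s \<circ> s = id"
    and finite_group: "finite (expressible S)"
    and exchange: "set u \<subseteq> S \<Longrightarrow> s \<in> S \<Longrightarrow>
      expression_length S (s \<circ> word_prod u) \<le> expression_length S (word_prod u) \<Longrightarrow>
      \<exists>a r b. u = a @ r # b \<and> s \<circ> word_prod u = word_prod (a @ b)"
begin

abbreviation W where "W \<equiv> expressible S"
abbreviation len where "len \<equiv> expression_length S"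
abbreviation reduced where "reduced \<equiv> reduced_expression S"

lemma involution_comp: "s \<in> S \<Longrightarrow> s \<circ> (s \<circ> w) = (w :: 'a \<Rightarrow> 'a)"
  using involution[of s] by (simp flip: comp_assoc)

lemma involution_comp_right: "s \<in> S \<Longrightarrow> w \<circ> s \<circ> s = (w :: 'a \<Rightarrow> 'a)"
  using involution[of s] by (simp add: comp_assoc)

lemma id_in: "id \<in> W"
  using expressible_word_prod[of "[]" S] by simp

lemma comp_in: "v \<in> W \<Longrightarrow> w \<in> W \<Longrightarrow> v \<circ> w \<in> W"
  unfolding expressible_def mem_Collect_eq
  by (metis set_append le_sup_iff word_prod_append)

lemma simple_in: "s \<in> S \<Longrightarrow> s \<in> W"
  using expressible_word_prod[of "[s]" S] by simp

lemma simple_comp_in: "s \<in> S \<Longrightarrow> s \<circ> w \<in> W \<longleftrightarrow> w \<in> W"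
  by (metis comp_in simple_in involution_comp)

lemma comp_simple_in: "s \<in> S \<Longrightarrow> w \<circ> s \<in> W \<longleftrightarrow> w \<in> W"
  by (metis comp_in simple_in involution_comp_right)

lemmas word_prod_rev = word_prod_rev_involutions[where S = S, OF involution]

lemma inv_word_prod: "set u \<subseteq> S \<Longrightarrow> inv (word_prod u) = word_prod (rev u)"
  using word_prod_rev[where u = u] word_prod_rev[where u = "rev u"] by (intro inv_unique_comp) simp_all

lemma bij_W: "w \<in> W \<Longrightarrow> bij w"
  unfolding expressible_def mem_Collect_eq
  by (metis o_bij word_prod_rev rev_rev_ident set_rev)

lemma inv_in: "w \<in> W \<Longrightarrow> inv w \<in> W"
  using inv_word_prod by (auto simp: expressible_def) (metis set_rev)

lemma inv_inv_W: "w \<in> W \<Longrightarrow> inv (inv w) = w"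
  by (simp add: bij_W inv_inv_eq)

lemma comp_cancel_right: "w \<in> W \<Longrightarrow> v \<circ> w = v' \<circ> w \<longleftrightarrow> v = v'"
  by (metis bij_W bij_is_surj comp_assoc comp_id surj_iff)

lemma len_id [simp]: "len id = 0"
  using expression_length_le[of "[]" S] by simp

lemma reducedD: "reduced u w \<Longrightarrow> set u \<subseteq> S" "reduced u w \<Longrightarrow> word_prod u = w"
    "reduced u w \<Longrightarrow> length u = len w"
  by (simp_all add: reduced_expression_iff)

lemma reduced_in: "reduced u w \<Longrightarrow> w \<in> W"
  using reducedD[of u w] by auto

lemma len_inv_le: "w \<in> W \<Longrightarrow> len (inv w) \<le> len w"
proof -
  assume "w \<in> W"
  then obtain u where u: "reduced u w" using ex_reduced_expression by blast
  then have "inv w = word_prod (rev u)" using inv_word_prod reducedD by blast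
  moreover have "set (rev u) \<subseteq> S" using reducedD(1)[OF u] by simp
  ultimately show ?thesis using expression_length_le[of "rev u" S] reducedD(3)[OF u] by simp
qed

lemma len_inv: "w \<in> W \<Longrightarrow> len (inv w) = len w"
  by (metis len_inv_le inv_in inv_inv_W le_antisym)

lemma len_simple_comp_le: "s \<in> S \<Longrightarrow> w \<in> W \<Longrightarrow> len (s \<circ> w) \<le> Suc (len w)"
proof -
  assume s: "s \<in> S" and "w \<in> W"
  then obtain u where u: "reduced u w" using ex_reduced_expression by blast
  then show ?thesis
    using expression_length_le[of "s # u" S] s reducedD[OF u] by simp
qed

lemma len_simple_comp_less:
  assumes s: "s \<in> S" and w: "w \<in> W" and le: "len (s \<circ> w) \<le> len w"
  shows "len (s \<circ> w) < len w"
proof -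
  obtain u where u: "reduced u w" using w ex_reduced_expression by blast
  have su: "set u \<subseteq> S" and pu: "word_prod u = w" and lu: "length u = len w"
    using reducedD[OF u] by auto
  obtain a r b where ab: "u = a @ r # b" "s \<circ> w = word_prod (a @ b)"
    using exchange[OF su s] le pu by auto
  have "len (word_prod (a @ b)) \<le> length (a @ b)"
    using su ab(1) by (intro expression_length_le) auto
  then show ?thesis using ab lu by simp
qed

lemma len_simple_comp:
  assumes s: "s \<in> S" and w: "w \<in> W"
  shows "len (s \<circ> w) = Suc (len w) \<or> len w = Suc (len (s \<circ> w))"
proof (cases "len (s \<circ> w) \<le> len w")
  case True
  then have "len (s \<circ> w) < len w" using len_simple_comp_less[OF s w] by blast
  moreover have "len w \<le> Suc (len (s \<circ> w))"
    using len_simple_comp_le[OF s, of "s \<circ> w"] simple_comp_in[OF s] w involution_comp[OF s] by simp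
  ultimately show ?thesis by simp
next
  case False
  then show ?thesis using len_simple_comp_le[OF s w] by simp
qed

lemma inv_comp_simple: "s \<in> S \<Longrightarrow> w \<in> W \<Longrightarrow> inv (w \<circ> s) = s \<circ> inv w"
proof -
  assume s: "s \<in> S" and w: "w \<in> W"
  have "inv s = s" using s involution by (intro inv_unique_comp) auto
  then show ?thesis using o_inv_distrib[of w s] bij_W[OF w] bij_W[OF simple_in[OF s]] by simp
qed

lemma len_comp_simple:
  assumes s: "s \<in> S" and w: "w \<in> W"
  shows "len (w \<circ> s) = Suc (len w) \<or> len w = Suc (len (w \<circ> s))"
  using len_simple_comp[OF s inv_in[OF w]] inv_comp_simple[OF s w] len_inv[OF w]
    len_inv[of "w \<circ> s"] comp_simple_in[OF s] w by simp

lemma reduced_Cons: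
  assumes "reduced (s # u) w"
  shows "reduced u (word_prod u)" "len w = Suc (len (word_prod u))" "s \<in> S" "w = s \<circ> word_prod u"
proof -
  have u: "set u \<subseteq> S" "s \<in> S" and w: "w = s \<circ> word_prod u" and l: "Suc (length u) = len w"
    using reducedD[OF assms] by auto
  have "len w \<le> Suc (len (word_prod u))" using len_simple_comp_le[of s "word_prod u"] u w by simp
  then have "length u = len (word_prod u)" using l expression_length_le[OF u(1)] by simp
  then show "reduced u (word_prod u)" "len w = Suc (len (word_prod u))" "s \<in> S" "w = s \<circ> word_prod u"
    using u w l by (auto simp: reduced_expression_iff)
qed

text \<open>If \<open>t\<close> lowered the length of \<open>w\<close> as well, the lengths could not match. Otherwise a reduced word of
\<open>w\<close> followed by \<open>t\<close> is reduced, and the exchange with \<open>s\<close> cannot delete a letter of \<open>w\<close>, whose length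
\<open>s\<close> raises; so it deletes the final \<open>t\<close>.\<close>

lemma descent_transport:
  assumes s: "s \<in> S" and t: "t \<in> S" and w: "w \<in> W"
    and up: "len w < len (s \<circ> w)" and down: "len (s \<circ> w \<circ> t) < len (w \<circ> t)"
  shows "s \<circ> w = w \<circ> t"
proof -
  have wt: "w \<circ> t \<in> W" using comp_simple_in[OF t] w by simp
  show ?thesis
  proof (cases "len (w \<circ> t) < len w")
    case True
    have "len (s \<circ> w) \<le> Suc (len (s \<circ> w \<circ> t))"
      using len_comp_simple[OF t, of "s \<circ> w \<circ> t"] involution_comp_right[OF t, of "s \<circ> w"]
        comp_simple_in[OF t] simple_comp_in[OF s] w by auto
    then show ?thesis using True down up by simp
  next
    case False
    then have l: "len (w \<circ> t) = Suc (len w)" using len_comp_simple[OF t w] by auto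
    obtain u where u: "reduced u w" using w ex_reduced_expression by blast
    have su: "set u \<subseteq> S" and pu: "word_prod u = w" and lu: "length u = len w"
      using reducedD[OF u] by auto
    obtain a r b where ab: "u @ [t] = a @ r # b" "s \<circ> (w \<circ> t) = word_prod (a @ b)"
      using exchange[of "u @ [t]" s] su s t down pu by (auto simp: comp_assoc)
    show ?thesis
    proof (cases b rule: rev_cases)
      case Nil
      then have "s \<circ> (w \<circ> t) = w" using ab pu by auto
      then show ?thesis using involution_comp_right[OF t] by (metis comp_assoc)
    next
      case (snoc b' x)
      then have u': "u = a @ r # b'" and x: "x = t" using ab(1) by auto
      have "s \<circ> w \<circ> t = word_prod (a @ b') \<circ> t" using ab(2) snoc x by (simp add: comp_assoc)
      then have "s \<circ> w = word_prod (a @ b')" using comp_cancel_right[OF simple_in[OF t]] by blast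
      moreover have "len (word_prod (a @ b')) \<le> length (a @ b')"
        using su u' by (intro expression_length_le) auto
      ultimately show ?thesis using up lu u' by simp
    qed
  qed
qed

text \<open>This is what makes the operators for left and right multiplication commute. The two implications
are the previous lemma for \<open>w\<close> and for \<open>w \<circ> t\<close>.\<close>

lemma descent_comp_simple:
  assumes s: "s \<in> S" and t: "t \<in> S" and w: "w \<in> W" and ne: "s \<circ> w \<noteq> w \<circ> t"
  shows "len (s \<circ> w \<circ> t) < len (w \<circ> t) \<longleftrightarrow> len (s \<circ> w) < len w"
proof -
  have wt: "w \<circ> t \<in> W" using comp_simple_in[OF t] w by simp
  have 1: "\<not> (len w < len (s \<circ> w) \<and> len (s \<circ> w \<circ> t) < len (w \<circ> t))"
    using descent_transport[OF s t w] ne by blast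
  have "\<not> (len (w \<circ> t) < len (s \<circ> (w \<circ> t)) \<and> len (s \<circ> w) < len w)"
  proof
    assume "len (w \<circ> t) < len (s \<circ> (w \<circ> t)) \<and> len (s \<circ> w) < len w"
    then have "s \<circ> (w \<circ> t) = w \<circ> t \<circ> t"
      using descent_transport[OF s t wt] involution_comp_right[OF t]
      by (metis comp_assoc)
    then have "s \<circ> w \<circ> t = w \<circ> t \<circ> t" by (simp add: comp_assoc)
    then show False using ne comp_cancel_right[OF simple_in[OF t]] by metis
  qed
  with 1 show ?thesis
    using len_simple_comp[OF s w] len_simple_comp[OF s wt] by (auto simp: comp_assoc)
qed

lemma funpow_comp_swap: "(s \<circ> t) ^^ n \<circ> s = s \<circ> (t \<circ> s) ^^ n"
  by (induction n) (auto simp: fun_eq_iff)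

lemma word_prod_alternating_swap:
  assumes "s \<in> S" "t \<in> S"
  shows "word_prod (alternating n s t) = (s \<circ> t) ^^ n \<circ> word_prod (alternating n t s)"
  using assms
proof (induction n arbitrary: s t)
  case (Suc n)
  have "(s \<circ> t) ^^ Suc n \<circ> word_prod (alternating (Suc n) t s) =
      (s \<circ> t) ^^ n \<circ> (s \<circ> (t \<circ> (t \<circ> word_prod (alternating n s t))))"
    by (simp only: funpow_Suc_right alternating.simps word_prod_Nil word_prod_Cons comp_assoc)
  also have "\<dots> = (s \<circ> t) ^^ n \<circ> s \<circ> word_prod (alternating n s t)"
    using involution_comp[OF Suc.prems(2)] by (simp add: comp_assoc)
  also have "\<dots> = s \<circ> ((t \<circ> s) ^^ n \<circ> word_prod (alternating n s t))"
    by (simp add: funpow_comp_swap comp_assoc)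
  finally show ?case
    unfolding alternating.simps word_prod_Cons Suc.IH[OF Suc.prems(2,1)] by (rule sym)
qed simp

lemma alternating_eq_iff:
  assumes "s \<in> S" "t \<in> S"
  shows "word_prod (alternating n s t) = word_prod (alternating n t s) \<longleftrightarrow> (s \<circ> t) ^^ n = id"
proof -
  have "set (alternating n t s) \<subseteq> S" using set_alternating[of n t s] assms by blast
  then have "word_prod (alternating n t s) \<in> W" by blast
  from comp_cancel_right[OF this, of "(s \<circ> t) ^^ n" id] show ?thesis
    using word_prod_alternating_swap[OF assms, of n] by simp
qed

lemma transformation_order:
  assumes "w \<in> W"
  shows "0 < transformation_order w" "w ^^ transformation_order w = id"
    "0 < j \<Longrightarrow> j < transformation_order w \<Longrightarrow> w ^^ j \<noteq> id"
proof -
  have pow: "w ^^ n \<in> W" for n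
    by (induction n) (simp_all only: funpow.simps id_in comp_in assms)
  then have "range (\<lambda>n. w ^^ n) \<subseteq> W" by auto
  then have "finite (range (\<lambda>n. w ^^ n))" using finite_group finite_subset by blast
  then have "\<not> inj (\<lambda>n. w ^^ n)" using finite_imageD infinite_UNIV_nat by blast
  then obtain i j where ij: "i < j" "w ^^ i = w ^^ j"
    unfolding inj_on_def by (metis linorder_neqE_nat)
  then have "w ^^ (j - i) \<circ> w ^^ i = id \<circ> w ^^ i" by (metis add_diff_inverse_nat comp_id diff_add_inverse2 funpow_add id_comp less_imp_not_less le_add_diff_inverse2 less_imp_le)
  then have "w ^^ (j - i) = id" using comp_cancel_right[OF pow] by blast
  then have "\<exists>n. 0 < n \<and> w ^^ n = id" using ij(1) by (intro exI[of _ "j - i"]) simp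
  from LeastI_ex[OF this] show "0 < transformation_order w" "w ^^ transformation_order w = id"
    unfolding transformation_order_def by auto
  show "0 < j \<Longrightarrow> j < transformation_order w \<Longrightarrow> w ^^ j \<noteq> id" for j
    unfolding transformation_order_def using not_less_Least by blast
qed

lemma dihedral_word:
  assumes "s \<in> S" "t \<in> S" "set u \<subseteq> {s, t}"
  shows "\<exists>j \<le> length u. word_prod u = word_prod (alternating j s t) \<or>
     word_prod u = word_prod (alternating j t s)"
  using assms(3)
proof (induction u)
  case (Cons x u)
  then obtain j where j: "j \<le> length u" "word_prod u = word_prod (alternating j s t) \<or>
     word_prod u = word_prod (alternating j t s)" by auto
  have "x \<circ> word_prod (alternating j x y) = word_prod (alternating (j - 1) y x) \<or> j = 0"
    if "x \<in> S" for x y using that by (cases j) (auto simp: involution_comp)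
  note cancel = this[OF assms(1)] this[OF assms(2)]
  have extend: "x \<circ> word_prod (alternating j y x) = word_prod (alternating (Suc j) x y)" for x y :: "'a \<Rightarrow> 'a"
    by simp
  have zero: "alternating 0 s t = alternating 0 t s" by simp
  consider "x = s" | "x = t" using Cons.prems by auto
  then show ?case
  proof cases
    case 1
    have "word_prod (x # u) = word_prod (alternating (j - 1) t s) \<or>
      word_prod (x # u) = word_prod (alternating (Suc j) s t)"
      using j(2) cancel(1)[of t] extend[of s t] zero 1 by auto
    moreover have "j - 1 \<le> length (x # u)" "Suc j \<le> length (x # u)" using j(1) by simp_all
    ultimately show ?thesis by blast
  next
    case 2
    have "word_prod (x # u) = word_prod (alternating (j - 1) s t) \<or>
      word_prod (x # u) = word_prod (alternating (Suc j) t s)"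
      using j(2) cancel(2)[of s] extend[of t s] zero 2 by auto
    moreover have "j - 1 \<le> length (x # u)" "Suc j \<le> length (x # u)" using j(1) by simp_all
    ultimately show ?thesis by blast
  qed
qed auto

lemma len_alternating_le: "s \<in> S \<Longrightarrow> t \<in> S \<Longrightarrow> len (word_prod (alternating n s t)) \<le> n"
  using expression_length_le[of "alternating n s t" S] set_alternating[of n s t] by auto

text \<open>If \<open>s t s \<dots>\<close> were not reduced, exchange would turn it into a word of length at most \<open>n - 1\<close> in \<open>s\<close>
and \<open>t\<close>, hence into a shorter alternating word. Cancelling the first letter then either shortens
\<open>t s t \<dots>\<close>, or identifies the two alternating words of length \<open>n\<close>.\<close>

lemma len_alternating_Suc:
  assumes s: "s \<in> S" and t: "t \<in> S" and ne: "s \<noteq> t"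
    and st: "\<And>i. i \<le> n \<Longrightarrow> len (word_prod (alternating i s t)) = i"
    and ts: "\<And>i. i \<le> n \<Longrightarrow> len (word_prod (alternating i t s)) = i"
    and distinct: "n > 0 \<Longrightarrow> word_prod (alternating n s t) \<noteq> word_prod (alternating n t s)"
  shows "len (word_prod (alternating (Suc n) s t)) = Suc n"
proof (rule ccontr)
  let ?A = "\<lambda>n. word_prod (alternating n s t)" and ?B = "\<lambda>n. word_prod (alternating n t s)"
  have sub: "set (alternating n t s) \<subseteq> S" using set_alternating[of n t s] s t by blast
  assume "len (?A (Suc n)) \<noteq> Suc n"
  then have "len (s \<circ> ?B n) \<le> len (?B n)"
    using len_alternating_le[OF s t, of "Suc n"] ts[of n] by simp
  then obtain a r b where ab: "alternating n t s = a @ r # b" "s \<circ> ?B n = word_prod (a @ b)"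
    using exchange[OF sub s] by blast
  have "set (a @ b) \<subseteq> {s, t}" using set_alternating[of n t s] ab(1) by auto
  then obtain j where j: "j \<le> length (a @ b)"
    "word_prod (a @ b) = ?A j \<or> word_prod (a @ b) = ?B j"
    using dihedral_word[OF s t] by blast
  have "Suc (length (a @ b)) = n" using ab(1) length_alternating[of n t s] by simp
  then have jn: "Suc j \<le> n" using j(1) by simp
  consider "s \<circ> ?B n = ?B j" | "s \<circ> ?B n = ?A j" using j(2) ab(2) by metis
  then show False
  proof cases
    case 1
    then have eq: "?B n = ?A (Suc j)"
      using involution_comp[OF s, of "?B n"] by simp
    then have "n = Suc j" using st[OF jn] ts[of n] by simp
    then show False using eq distinct by simp
  next
    case 2
    show False
    proof (cases j)
      case 0
      then have "s \<circ> ?B n = id" using 2 by simp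
      then have B: "?B n = s" using involution_comp[OF s, of "?B n"] by simp
      have "len s \<le> 1" using expression_length_le[of "[s]" S] s by simp
      then have "n = 1" using ts[of n] B jn by simp
      then show False using B ne by simp
    next
      case (Suc i)
      then have "s \<circ> ?B n = s \<circ> ?B i" using 2 by (simp only: alternating.simps word_prod_Cons)
      then have "s \<circ> (s \<circ> ?B n) = s \<circ> (s \<circ> ?B i)" by (rule arg_cong)
      then have "?B n = ?B i" unfolding involution_comp[OF s] .
      then show False using ts[of n] ts[of i] jn Suc by simp
    qed
  qed
qed

lemma len_alternating:
  assumes s: "s \<in> S" and t: "t \<in> S" and ne: "s \<noteq> t" and n: "n \<le> transformation_order (s \<circ> t)"
  shows "len (word_prod (alternating n s t)) = n \<and> len (word_prod (alternating n t s)) = n"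
  using n
proof (induction n rule: less_induct)
  case (less n)
  show ?case
  proof (cases n)
    case (Suc k)
    have W: "s \<circ> t \<in> W" using s t simple_in comp_in by blast
    have neq: "word_prod (alternating k s t) \<noteq> word_prod (alternating k t s)" if "k > 0"
      using transformation_order(3)[OF W that] alternating_eq_iff[OF s t] less.prems Suc by simp
    have IH: "len (word_prod (alternating i s t)) = i" "len (word_prod (alternating i t s)) = i"
      if "i \<le> k" for i using less.IH[of i] less.prems that Suc by auto
    show ?thesis
      unfolding Suc using IH neq s t ne
      by (metis len_alternating_Suc)
  qed (simp only: alternating.simps word_prod_Nil len_id)
qed

text \<open>Two left descents \<open>s\<close> and \<open>t\<close> of \<open>w\<close> force the longest element of their dihedral group to be a
prefix of \<open>w\<close>. The prefix is built letter by letter: exchanging the descent that does not start the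
current prefix cannot delete a letter of the prefix, because alternating words up to this length are
reduced. Which letter comes first is not controlled on the way.\<close>

lemma reduced_alternating_prefix:
  assumes s: "s \<in> S" and t: "t \<in> S" and ne: "s \<noteq> t" and w: "w \<in> W"
    and ds: "len (s \<circ> w) < len w" and dt: "len (t \<circ> w) < len w"
    and n: "n \<le> transformation_order (s \<circ> t)"
  shows "\<exists>x. reduced (alternating n s t @ x) w \<or> reduced (alternating n t s @ x) w"
proof -
  have extend: "\<exists>x'. reduced (alternating (Suc n) s t @ x') w"
    if s: "s \<in> S" and t: "t \<in> S" and ds: "len (s \<circ> w) < len w"
      and long: "len (word_prod (alternating (Suc n) s t)) = Suc n"
      and x: "reduced (alternating n t s @ x) w" for n s t x
  proof -
    let ?u = "alternating n t s"
    have sub: "set ?u \<subseteq> S" "set x \<subseteq> S" and pw: "w = word_prod ?u \<circ> word_prod x"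
      and lw: "n + length x = len w" using reducedD[OF x] by auto
    have "\<exists>a r b. ?u @ x = a @ r # b \<and> s \<circ> word_prod (?u @ x) = word_prod (a @ b)"
      using sub s ds pw by (intro exchange) auto
    then obtain a r b where ab: "?u @ x = a @ r # b" "s \<circ> w = word_prod (a @ b)"
      using pw by auto
    show ?thesis
    proof (cases "length a < n")
      case True
      then obtain c where c: "?u = a @ c" "c @ x = r # b"
        using ab(1) by (auto simp: append_eq_append_conv2 dest: arg_cong[of _ _ length])
      moreover have "c \<noteq> []" using c(1) True by (auto dest: arg_cong[of _ _ length])
      ultimately obtain b' where b': "?u = a @ r # b'" "b = b' @ x"
        by (cases c) auto
      have "s \<circ> word_prod ?u \<circ> word_prod x = word_prod (a @ b') \<circ> word_prod x"
        using ab(2) pw b' by (simp add: comp_assoc)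
      then have "s \<circ> word_prod ?u = word_prod (a @ b')"
        using comp_cancel_right sub(2) by blast
      moreover have "len (word_prod (a @ b')) \<le> length (a @ b')"
        using sub(1) b'(1) by (intro expression_length_le) auto
      moreover have "length (a @ b') < n" using b'(1) length_alternating[of n t s] by simp
      ultimately show ?thesis using long by simp
    next
      case False
      then obtain a' where a': "a = ?u @ a'" "x = a' @ r # b"
        using ab(1) append_eq_append_conv_if[of ?u x a "r # b"]
        by (metis append_eq_append_conv_if length_alternating not_less append_take_drop_id)
      have "w = s \<circ> word_prod (a @ b)" using ab(2) involution_comp[OF s, of w] by simp
      then have "word_prod (alternating (Suc n) s t @ a' @ b) = w" using a' by (simp add: comp_assoc)
      moreover have "length (alternating (Suc n) s t @ a' @ b) = len w" using lw a' by simp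
      moreover have "set (alternating (Suc n) s t @ a' @ b) \<subseteq> S" using sub s a' by auto
      ultimately show ?thesis unfolding reduced_expression_iff by blast
    qed
  qed
  show ?thesis using n
  proof (induction n)
    case 0
    then show ?case using ex_reduced_expression[OF w] by simp
  next
    case (Suc n)
    then obtain x where "reduced (alternating n s t @ x) w \<or> reduced (alternating n t s @ x) w" by auto
    then show ?case
      using extend[OF s t ds, of n x] extend[OF t s dt, of n x] len_alternating[OF s t ne Suc.prems]
      by metis
  qed
qed

text \<open>Two reduced words of \<open>w\<close> with the same first letter are treated by induction on their tails. If
their first letters are \<open>s \<noteq> t\<close>, both words are connected, through words with the same first letter,
to reduced words that begin with the two alternating words in \<open>s\<close> and \<open>t\<close>, and these differ by one
braid move.\<close>

theorem matsumoto:
  assumes "reduced u w" "reduced u' w"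
  shows "(braid_move S)\<^sup>*\<^sup>* u u'"
  using assms
proof (induction "length u" arbitrary: u u' w)
  case 0
  then show ?case using reducedD(3)[of u w] reducedD(3)[of u' w] by simp
next
  case (Suc n)
  have "length u' = length u" using reducedD(3) Suc.prems by metis
  then obtain s v t v' where u: "u = s # v" and u': "u' = t # v'"
    using Suc.hyps(2) by (metis length_Suc_conv)
  have tails: "(braid_move S)\<^sup>*\<^sup>* (s # v) (s # v')"
    if "reduced (s # v) w" "reduced (s # v') w" "length v = n" for s v v'
  proof -
    have "s \<circ> (s \<circ> word_prod v) = s \<circ> (s \<circ> word_prod v')"
      using reduced_Cons(4)[OF that(1)] reduced_Cons(4)[OF that(2)] by simp
    then have "word_prod v = word_prod v'"
      using reduced_Cons(3)[OF that(1)] by (simp add: involution_comp)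
    then have "(braid_move S)\<^sup>*\<^sup>* v v'"
      using Suc.hyps(1)[of v "word_prod v" v'] that(3) reduced_Cons(1)[OF that(1)]
        reduced_Cons(1)[OF that(2)] by simp
    then show ?thesis using braid_moves_Cons reduced_Cons(3)[OF that(1)] by blast
  qed
  have v: "length v = n" "length v' = n"
    using Suc.hyps(2) u u' \<open>length u' = length u\<close> by simp_all
  show ?case
  proof (cases "s = t")
    case True
    then show ?thesis using tails Suc.prems u u' v by simp
  next
    case False
    have ds: "s \<in> S" "len (s \<circ> w) < len w" and dt: "t \<in> S" "len (t \<circ> w) < len w"
      using reduced_Cons[of s v w] reduced_Cons[of t v' w] Suc.prems u u'
        involution_comp[of s "word_prod v"] involution_comp[of t "word_prod v'"]
      by (metis lessI)+
    let ?m = "transformation_order (s \<circ> t)"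
    have W: "s \<circ> t \<in> W" using ds dt simple_in comp_in by blast
    have m: "?m > 0" by (rule transformation_order[OF W])
    have eq: "word_prod (alternating ?m s t) = word_prod (alternating ?m t s)"
      using alternating_eq_iff[OF ds(1) dt(1)] transformation_order[OF W] by blast
    obtain x where "reduced (alternating ?m s t @ x) w \<or> reduced (alternating ?m t s @ x) w"
      using reduced_alternating_prefix[OF ds(1) dt(1) False _ ds(2) dt(2)] Suc.prems reduced_in by blast
    then have x: "reduced (alternating ?m s t @ x) w" "reduced (alternating ?m t s @ x) w"
      using eq set_alternating[of ?m s t] set_alternating[of ?m t s] ds(1) dt(1)
      by (auto simp: reduced_expression_iff)
    have xS: "set x \<subseteq> S" using reducedD(1)[OF x(1)] by simp
    obtain p where p: "?m = Suc p" using m by (cases ?m) auto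
    have "(braid_move S)\<^sup>*\<^sup>* u (alternating ?m s t @ x)"
      using tails[of s v "alternating p t s @ x"] x(1) Suc.prems(1) u p v by simp
    also have "braid_move S (alternating ?m s t @ x) (alternating ?m t s @ x)"
      unfolding braid_move_def using ds dt False xS
      by (intro exI[of _ "[]"] exI[of _ x] exI[of _ s] exI[of _ t]) auto
    also have "(braid_move S)\<^sup>*\<^sup>* (alternating ?m t s @ x) u'"
    proof -
      have "length (alternating p s t @ x) = n"
        using reducedD(3)[OF x(2)] reducedD(3)[OF Suc.prems(1)] Suc.hyps(2) p by simp
      then show ?thesis
        using tails[of t "alternating p s t @ x" v'] x(2) Suc.prems(2) u' p by simp
    qed
    finally show ?thesis .
  qed
qed

end

section \<open>The exchange condition for Weyl groups\<close>

lemma reflection_minus: "reflection \<alpha> (- x) = - reflection \<alpha> x"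
  by (simp add: reflection_def)

lemma reflection_self: "\<alpha> \<noteq> 0 \<Longrightarrow> reflection \<alpha> \<alpha> = - \<alpha>"
  by (simp add: reflection_def scaleR_2)

lemma reflection_uminus: "reflection (- \<alpha>) = reflection \<alpha>"
  by (simp add: reflection_def fun_eq_iff)

lemma reflection_diff_scale: "reflection \<alpha> (x - c *\<^sub>R y) = reflection \<alpha> x - c *\<^sub>R reflection \<alpha> y"
  by (simp add: reflection_def algebra_simps diff_divide_distrib)

lemma reflection_reflection: "\<alpha> \<noteq> 0 \<Longrightarrow> reflection \<alpha> (reflection \<alpha> x) = x"
  unfolding reflection_def[of \<alpha> x] reflection_diff_scale
  by (simp add: reflection_self)

lemma reflection_involution: "\<alpha> \<noteq> 0 \<Longrightarrow> reflection \<alpha> \<circ> reflection \<alpha> = id"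
  by (simp add: fun_eq_iff reflection_reflection)

lemma inner_reflection_left: "reflection \<alpha> x \<bullet> y = x \<bullet> reflection \<alpha> y"
  by (simp add: reflection_def inner_diff_left inner_diff_right inner_commute)

lemma inner_reflection: "\<alpha> \<noteq> 0 \<Longrightarrow> reflection \<alpha> x \<bullet> reflection \<alpha> y = x \<bullet> y"
  by (simp add: inner_reflection_left reflection_reflection)

lemma reflection_conjugate:
  assumes "\<beta> \<noteq> 0"
  shows "reflection (reflection \<beta> \<gamma>) (reflection \<beta> x) = reflection \<beta> (reflection \<gamma> x)"
proof -
  have "reflection (reflection \<beta> \<gamma>) (reflection \<beta> x) =
      reflection \<beta> x - (2 * (x \<bullet> \<gamma>) / (\<gamma> \<bullet> \<gamma>)) *\<^sub>R reflection \<beta> \<gamma>"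
    unfolding reflection_def[of "reflection \<beta> \<gamma>"] inner_reflection[OF assms] ..
  then show ?thesis unfolding reflection_def[of \<gamma>] reflection_diff_scale .
qed

locale based_root_system =
  fixes \<Phi> \<Delta> :: "'a::euclidean_space set"
  assumes root_system: "root_system \<Phi>" and root_base: "root_base \<Phi> \<Delta>"
begin

abbreviation S where "S \<equiv> simple_reflections \<Delta>"

definition positive :: "'a \<Rightarrow> bool" where
  "positive \<gamma> \<longleftrightarrow> \<gamma> \<in> \<Phi> \<and> (\<exists>c :: 'a \<Rightarrow> nat. \<gamma> = (\<Sum>\<delta>\<in>\<Delta>. real (c \<delta>) *\<^sub>R \<delta>))"

lemma simple_root: "\<delta> \<in> \<Delta> \<Longrightarrow> \<delta> \<in> \<Phi>"
  using root_base by (auto simp: root_base_def)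

lemma root_nonzero: "\<gamma> \<in> \<Phi> \<Longrightarrow> \<gamma> \<noteq> 0"
  using root_system by (auto simp: root_system_def)

lemma finite_base: "finite \<Delta>"
  using root_system root_base finite_subset by (auto simp: root_system_def root_base_def)

lemma reflection_root: "\<alpha> \<in> \<Phi> \<Longrightarrow> \<gamma> \<in> \<Phi> \<Longrightarrow> reflection \<alpha> \<gamma> \<in> \<Phi>"
  using root_system by (auto simp: root_system_def)

lemma uminus_root: "\<gamma> \<in> \<Phi> \<Longrightarrow> - \<gamma> \<in> \<Phi>"
  using reflection_root[of \<gamma> \<gamma>] reflection_self[OF root_nonzero] by simp

lemma coefficients_unique:
  assumes "(\<Sum>\<delta>\<in>\<Delta>. a \<delta> *\<^sub>R \<delta>) = (\<Sum>\<delta>\<in>\<Delta>. b \<delta> *\<^sub>R \<delta>)" "\<delta> \<in> \<Delta>"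
  shows "a \<delta> = b \<delta>"
proof -
  have "(\<Sum>\<delta>\<in>\<Delta>. (a \<delta> - b \<delta>) *\<^sub>R \<delta>) = 0"
    using assms(1) by (simp add: scaleR_diff_left sum_subtractf)
  moreover have "independent \<Delta>" using root_base by (simp add: root_base_def)
  ultimately have "a \<delta> - b \<delta> = 0"
    using independentD[of \<Delta> \<Delta> "\<lambda>\<delta>. a \<delta> - b \<delta>" \<delta>] finite_base assms(2) by simp
  then show ?thesis by simp
qed

lemma positive_or_negative: "\<gamma> \<in> \<Phi> \<Longrightarrow> positive \<gamma> \<or> positive (- \<gamma>)"
proof -
  assume g: "\<gamma> \<in> \<Phi>"
  then obtain c :: "'a \<Rightarrow> nat" where
    c: "\<gamma> = (\<Sum>\<delta>\<in>\<Delta>. real (c \<delta>) *\<^sub>R \<delta>) \<or> \<gamma> = - (\<Sum>\<delta>\<in>\<Delta>. real (c \<delta>) *\<^sub>R \<delta>)"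
    using root_base unfolding root_base_def by blast
  then show ?thesis
  proof
    assume "\<gamma> = (\<Sum>\<delta>\<in>\<Delta>. real (c \<delta>) *\<^sub>R \<delta>)"
    then show ?thesis using g unfolding positive_def by blast
  next
    assume "\<gamma> = - (\<Sum>\<delta>\<in>\<Delta>. real (c \<delta>) *\<^sub>R \<delta>)"
    then have "- \<gamma> = (\<Sum>\<delta>\<in>\<Delta>. real (c \<delta>) *\<^sub>R \<delta>)" by simp
    then show ?thesis using uminus_root[OF g] unfolding positive_def by blast
  qed
qed

lemma positive_if_coefficient:
  assumes g: "\<gamma> \<in> \<Phi>" "\<gamma> = (\<Sum>\<delta>\<in>\<Delta>. a \<delta> *\<^sub>R \<delta>)" and d: "\<delta> \<in> \<Delta>" "a \<delta> > 0"
  shows "positive \<gamma>"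
proof (rule ccontr)
  assume "\<not> positive \<gamma>"
  then obtain c :: "'a \<Rightarrow> nat" where "- \<gamma> = (\<Sum>\<delta>\<in>\<Delta>. real (c \<delta>) *\<^sub>R \<delta>)"
    using positive_or_negative[OF g(1)] unfolding positive_def by blast
  then have "\<gamma> = - (\<Sum>\<delta>\<in>\<Delta>. real (c \<delta>) *\<^sub>R \<delta>)" by (metis minus_minus)
  then have "(\<Sum>\<delta>\<in>\<Delta>. a \<delta> *\<^sub>R \<delta>) = (\<Sum>\<delta>\<in>\<Delta>. (- real (c \<delta>)) *\<^sub>R \<delta>)"
    using g(2) by (simp add: sum_negf)
  from coefficients_unique[OF this d(1)] show False using d(2) by simp
qed

lemma positive_coefficient:
  assumes "positive \<gamma>" "\<gamma> = (\<Sum>\<delta>\<in>\<Delta>. a \<delta> *\<^sub>R \<delta>)" "\<delta> \<in> \<Delta>"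
  shows "a \<delta> \<ge> 0"
proof -
  obtain c :: "'a \<Rightarrow> nat" where "\<gamma> = (\<Sum>\<delta>\<in>\<Delta>. real (c \<delta>) *\<^sub>R \<delta>)"
    using assms(1) unfolding positive_def by blast
  then have "a \<delta> = real (c \<delta>)" using coefficients_unique[OF _ assms(3)] assms(2) by metis
  then show ?thesis by simp
qed

lemma not_positive_both: "positive \<gamma> \<Longrightarrow> \<not> positive (- \<gamma>)"
proof
  assume p: "positive \<gamma>" and n: "positive (- \<gamma>)"
  then obtain c :: "'a \<Rightarrow> nat" where c: "\<gamma> = (\<Sum>\<delta>\<in>\<Delta>. real (c \<delta>) *\<^sub>R \<delta>)"
    unfolding positive_def by blast
  have "- \<gamma> = (\<Sum>\<delta>\<in>\<Delta>. (- real (c \<delta>)) *\<^sub>R \<delta>)" unfolding c by (simp add: sum_negf)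
  then have "- real (c \<delta>) \<ge> 0" if "\<delta> \<in> \<Delta>" for \<delta> by (rule positive_coefficient[OF n _ that])
  then have "\<gamma> = 0" unfolding c by (intro sum.neutral) simp
  then show False using p root_nonzero unfolding positive_def by blast
qed

lemma positive_simple:
  assumes "\<delta> \<in> \<Delta>" shows "positive \<delta>"
proof -
  have "\<delta> = (\<Sum>\<epsilon>\<in>\<Delta>. (if \<epsilon> = \<delta> then 1 else 0) *\<^sub>R \<epsilon>)"
    using assms finite_base by (simp add: if_distrib[of "\<lambda>c. c *\<^sub>R _"] cong: if_cong)
  then show ?thesis by (rule positive_if_coefficient[OF simple_root[OF assms] _ assms]) simp
qed

lemma reflection_coefficients:
  assumes "\<delta> \<in> \<Delta>"
  shows "reflection \<delta> (\<Sum>\<epsilon>\<in>\<Delta>. c \<epsilon> *\<^sub>R \<epsilon>) =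
    (\<Sum>\<epsilon>\<in>\<Delta>. (c \<epsilon> - (if \<epsilon> = \<delta> then 2 * ((\<Sum>\<epsilon>\<in>\<Delta>. c \<epsilon> *\<^sub>R \<epsilon>) \<bullet> \<delta>) / (\<delta> \<bullet> \<delta>) else 0)) *\<^sub>R \<epsilon>)"
  using assms finite_base unfolding reflection_def
  by (simp add: scaleR_diff_left sum_subtractf if_distrib[of "\<lambda>c. c *\<^sub>R _"] cong: if_cong)

text \<open>A positive root other than \<open>\<delta>\<close> is not a multiple of \<open>\<delta>\<close>, so it has a positive coefficient at another
simple root. The reflection in \<open>\<delta>\<close> keeps this coefficient, and one positive coefficient decides the
sign of a root.\<close>

lemma simple_reflection_positive:
  assumes d: "\<delta> \<in> \<Delta>" and g: "positive \<gamma>" and ne: "\<gamma> \<noteq> \<delta>"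
  shows "positive (reflection \<delta> \<gamma>)"
proof -
  obtain c :: "'a \<Rightarrow> nat" where c: "\<gamma> = (\<Sum>\<epsilon>\<in>\<Delta>. real (c \<epsilon>) *\<^sub>R \<epsilon>)" and gr: "\<gamma> \<in> \<Phi>"
    using g unfolding positive_def by blast
  have "\<exists>\<epsilon>\<in>\<Delta>. \<epsilon> \<noteq> \<delta> \<and> c \<epsilon> > 0"
  proof (rule ccontr)
    assume "\<not> ?thesis"
    then have "\<gamma> = (\<Sum>\<epsilon>\<in>\<Delta>. if \<epsilon> = \<delta> then real (c \<delta>) *\<^sub>R \<delta> else 0)"
      unfolding c by (intro sum.cong) auto
    then have gd: "\<gamma> = real (c \<delta>) *\<^sub>R \<delta>" using d finite_base by simp
    then have "real (c \<delta>) = 1 \<or> real (c \<delta>) = -1"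
      using root_system simple_root[OF d] gr unfolding root_system_def by metis
    then have "real (c \<delta>) = 1" by simp
    then show False using gd ne by simp
  qed
  then obtain \<epsilon> where e: "\<epsilon> \<in> \<Delta>" "\<epsilon> \<noteq> \<delta>" "c \<epsilon> > 0" by blast
  show ?thesis
  proof (rule positive_if_coefficient[OF reflection_root[OF simple_root[OF d] gr] _ e(1)])
    show "reflection \<delta> \<gamma> = (\<Sum>\<epsilon>\<in>\<Delta>.
        (real (c \<epsilon>) - (if \<epsilon> = \<delta> then 2 * (\<gamma> \<bullet> \<delta>) / (\<delta> \<bullet> \<delta>) else 0)) *\<^sub>R \<epsilon>)"
      unfolding c by (rule reflection_coefficients[OF d])
  qed (use e in simp)
qed

lemma simple_reflectionE:
  assumes "s \<in> S" obtains \<delta> where "\<delta> \<in> \<Delta>" "s = reflection \<delta>"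
  using assms by (auto simp: simple_reflections_def)

lemma simple_reflection_involution: "s \<in> S \<Longrightarrow> s \<circ> s = id"
  using reflection_involution[OF root_nonzero[OF simple_root]] by (auto simp: simple_reflections_def)

lemmas simple_word_prod_rev = word_prod_rev_involutions[where S = S, OF simple_reflection_involution]

lemma word_prod_rev_apply:
  "set u \<subseteq> S \<Longrightarrow> word_prod u (word_prod (rev u) x) = x"
  "set u \<subseteq> S \<Longrightarrow> word_prod (rev u) (word_prod u x) = x"
  using simple_word_prod_rev[of u] simple_word_prod_rev[of "rev u"] by (auto dest: fun_cong)

lemma word_prod_root: "set u \<subseteq> S \<Longrightarrow> \<gamma> \<in> \<Phi> \<Longrightarrow> word_prod u \<gamma> \<in> \<Phi>"
  by (induction u) (auto simp: simple_reflections_def intro: reflection_root simple_root)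

lemma word_prod_uminus: "set u \<subseteq> S \<Longrightarrow> word_prod u (- x) = - word_prod u x"
  by (induction u) (auto simp: simple_reflections_def reflection_minus)

text \<open>Letting the letters of \<open>u\<close> act on \<open>\<gamma>\<close> one after the other, the root becomes negative at some letter
\<open>s\<close>. A simple reflection makes only its own root negative, so at that moment the root is the one of
\<open>s\<close>, and the reflection in \<open>\<gamma>\<close> is the conjugate of \<open>s\<close> by the preceding letters: multiplying by it
deletes \<open>s\<close>. The induction needs arbitrary positive roots, although only simple ones are of interest
in the end.\<close>

lemma strong_exchange:
  assumes "set u \<subseteq> S" "positive \<gamma>" "positive (- word_prod (rev u) \<gamma>)"
  shows "\<exists>a r b. u = a @ r # b \<and> reflection \<gamma> \<circ> word_prod u = word_prod (a @ b)"
  using assms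
proof (induction u arbitrary: \<gamma>)
  case Nil
  then show ?case using not_positive_both by simp
next
  case (Cons s u)
  have u: "set u \<subseteq> S" and s: "s \<in> S" using Cons.prems(1) by auto
  obtain \<beta> where b: "\<beta> \<in> \<Delta>" "s = reflection \<beta>" using s simple_reflectionE by blast
  have nz: "\<beta> \<noteq> 0" using root_nonzero simple_root b(1) by blast
  show ?case
  proof (cases "\<gamma> = \<beta>")
    case True
    have "reflection \<gamma> \<circ> word_prod (s # u) = word_prod ([] @ u)"
      using reflection_reflection[OF nz] True b(2) by (simp add: fun_eq_iff)
    then show ?thesis by blast
  next
    case False
    let ?\<gamma> = "reflection \<beta> \<gamma>"
    have "positive ?\<gamma>" using simple_reflection_positive[OF b(1) Cons.prems(2) False] .
    moreover have "positive (- word_prod (rev u) ?\<gamma>)" using Cons.prems(3) b(2) by simp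
    ultimately obtain a r b' where ab: "u = a @ r # b'"
      "reflection ?\<gamma> \<circ> word_prod u = word_prod (a @ b')"
      using Cons.IH[OF u] by blast
    have "reflection \<gamma> (reflection \<beta> x) = reflection \<beta> (reflection ?\<gamma> x)" for x
      using reflection_conjugate[OF nz, of ?\<gamma> x] reflection_reflection[OF nz, of \<gamma>] by simp
    then have "reflection \<gamma> \<circ> word_prod (s # u) = reflection \<beta> \<circ> (reflection ?\<gamma> \<circ> word_prod u)"
      using b(2) by (simp add: fun_eq_iff)
    also have "\<dots> = word_prod ((s # a) @ b')" unfolding ab(2) using b(2) by simp
    finally have "reflection \<gamma> \<circ> word_prod (s # u) = word_prod ((s # a) @ b')" .
    moreover have "s # u = (s # a) @ r # b'" using ab(1) by simp
    ultimately show ?thesis by blast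
  qed
qed

text \<open>Otherwise \<open>\<delta>\<close> is made negative by the inverse of a reduced word of \<open>s \<circ> u\<close>, where \<open>s\<close> is the reflection in \<open>\<delta>\<close>, and
the strong exchange makes \<open>u\<close> shorter than that word.\<close>

lemma descent_negative:
  assumes u: "set u \<subseteq> S" and d: "\<delta> \<in> \<Delta>"
    and le: "expression_length S (reflection \<delta> \<circ> word_prod u) \<le> expression_length S (word_prod u)"
  shows "positive (- word_prod (rev u) \<delta>)"
proof (rule ccontr)
  assume "\<not> ?thesis"
  then have pos: "positive (word_prod (rev u) \<delta>)"
    using positive_or_negative[of "word_prod (rev u) \<delta>"] word_prod_root[of "rev u" \<delta>]
      u simple_root[OF d] by auto
  have nz: "\<delta> \<noteq> 0" using root_nonzero simple_root d by blast
  have s: "reflection \<delta> \<in> S" using d by (simp add: simple_reflections_def)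
  have "reflection \<delta> \<circ> word_prod u \<in> expressible S"
    using expressible_word_prod[of "reflection \<delta> # u" S] s u by simp
  then obtain x where x: "reduced_expression S x (reflection \<delta> \<circ> word_prod u)"
    using ex_reduced_expression by blast
  then have xS: "set x \<subseteq> S" and px: "word_prod x = reflection \<delta> \<circ> word_prod u"
    and lx: "length x = expression_length S (reflection \<delta> \<circ> word_prod u)"
    by (simp_all add: reduced_expression_iff)
  have "word_prod x (word_prod (rev u) (- \<delta>)) = \<delta>"
    unfolding px using word_prod_rev_apply(1)[OF u] reflection_self[OF nz]
    by (simp add: reflection_minus)
  then have "word_prod (rev x) \<delta> = - word_prod (rev u) \<delta>"
    using word_prod_rev_apply(2)[OF xS] word_prod_uminus[of "rev u"] u by (metis set_rev)
  then have "positive (- word_prod (rev x) \<delta>)" using pos by simp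
  then obtain a r b where ab: "x = a @ r # b" "reflection \<delta> \<circ> word_prod x = word_prod (a @ b)"
    using strong_exchange[OF xS positive_simple[OF d]] by blast
  have "word_prod u = word_prod (a @ b)"
    using ab(2) px reflection_reflection[OF nz] by (simp add: fun_eq_iff)
  then have "expression_length S (word_prod u) \<le> length (a @ b)"
    using expression_length_le[of "a @ b" S] xS ab(1) by auto
  then show False using le lx ab(1) by simp
qed

text \<open>The first letter of a nonempty reduced word lowers the length, hence its root becomes negative
and is not fixed. This shows that an element is determined by its values on the base, which yields
finiteness of the group even if the roots do not span the space.\<close>

lemma fixes_base_imp_id:
  assumes u: "set u \<subseteq> S" and stable: "\<And>\<delta>. \<delta> \<in> \<Delta> \<Longrightarrow> word_prod u \<delta> = \<delta>"
  shows "word_prod u = id"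
proof -
  obtain x where "reduced_expression S x (word_prod u)"
    using ex_reduced_expression[OF expressible_word_prod[OF u]] by blast
  then have x: "set x \<subseteq> S" "word_prod x = word_prod u" "length x = expression_length S (word_prod u)"
    by (simp_all add: reduced_expression_iff)
  show ?thesis
  proof (cases x)
    case Nil
    then show ?thesis using x(2) by simp
  next
    case (Cons s y)
    then obtain \<delta> where d: "\<delta> \<in> \<Delta>" "s = reflection \<delta>" using x(1) simple_reflectionE by auto
    then have nz: "\<delta> \<noteq> 0" using root_nonzero simple_root by blast
    have "reflection \<delta> \<circ> word_prod x = word_prod y"
      using Cons d(2) reflection_reflection[OF nz] by (simp add: fun_eq_iff)
    then have "expression_length S (reflection \<delta> \<circ> word_prod x) \<le> expression_length S (word_prod x)"
      using expression_length_le[of y S] x Cons by simp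
    then have "positive (- word_prod (rev x) \<delta>)" using descent_negative[OF x(1) d(1)] by blast
    moreover have "word_prod (rev x) \<delta> = \<delta>"
      using word_prod_rev_apply(2)[OF x(1), of \<delta>] stable[OF d(1)] x(2) by simp
    ultimately show ?thesis using positive_simple[OF d(1)] not_positive_both by simp
  qed
qed

lemma finite_expressible: "finite (expressible S)"
proof (rule inj_on_finite)
  show "inj_on (\<lambda>w. restrict w \<Delta>) (expressible S)"
  proof (rule inj_onI)
    fix v w assume "v \<in> expressible S" "w \<in> expressible S" and eq: "restrict v \<Delta> = restrict w \<Delta>"
    then obtain a b where a: "set a \<subseteq> S" "v = word_prod a" and b: "set b \<subseteq> S" "w = word_prod b"
      unfolding expressible_def by blast
    have "word_prod a \<delta> = word_prod b \<delta>" if "\<delta> \<in> \<Delta>" for \<delta>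
      using fun_cong[OF eq, of \<delta>] that a b by simp
    then have "word_prod (rev b @ a) = id"
      using a b word_prod_rev_apply(2)[OF b(1)] by (intro fixes_base_imp_id) auto
    then have "word_prod b (word_prod (rev b) (word_prod a x)) = word_prod b x" for x
      by (simp add: fun_eq_iff)
    then show "v = w" unfolding a(2) b(2) using word_prod_rev_apply(1)[OF b(1)] by (simp add: fun_eq_iff)
  qed
  show "(\<lambda>w. restrict w \<Delta>) ` expressible S \<subseteq> \<Delta> \<rightarrow>\<^sub>E \<Phi>"
    unfolding expressible_def using word_prod_root simple_root by auto
  show "finite (\<Delta> \<rightarrow>\<^sub>E \<Phi>)"
    using finite_base root_system by (intro finite_PiE) (auto simp: root_system_def)
qed

sublocale coxeter_group S
proof
  show "finite (expressible S)" by (rule finite_expressible)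
next
  fix u s assume u: "set u \<subseteq> S" and s: "s \<in> S"
    and le: "expression_length S (s \<circ> word_prod u) \<le> expression_length S (word_prod u)"
  obtain \<delta> where d: "\<delta> \<in> \<Delta>" "s = reflection \<delta>" using s simple_reflectionE by blast
  show "\<exists>a r b. u = a @ r # b \<and> s \<circ> word_prod u = word_prod (a @ b)"
    using strong_exchange[OF u positive_simple[OF d(1)]] descent_negative[OF u d(1)] le d(2) by blast
qed (rule simple_reflection_involution)

text \<open>The sum of the coefficients of a positive root drops when it is reflected in a simple root that
has a positive inner product with it. This reduces to simple roots by conjugation.\<close>

lemma reflection_expressible:
  assumes "\<gamma> \<in> \<Phi>" "\<gamma> = (\<Sum>\<delta>\<in>\<Delta>. real (c \<delta>) *\<^sub>R \<delta>)"
  shows "reflection \<gamma> \<in> expressible S"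
  using assms
proof (induction "\<Sum>\<delta>\<in>\<Delta>. c \<delta>" arbitrary: \<gamma> c rule: less_induct)
  case less
  have "\<gamma> \<bullet> \<gamma> > 0" using root_nonzero[OF less.prems(1)] by simp
  moreover have "\<gamma> \<bullet> \<gamma> = (\<Sum>\<delta>\<in>\<Delta>. real (c \<delta>) * (\<delta> \<bullet> \<gamma>))"
    by (subst (1) less.prems(2)) (simp add: inner_sum_left)
  ultimately have "\<not> (\<Sum>\<delta>\<in>\<Delta>. real (c \<delta>) * (\<delta> \<bullet> \<gamma>)) \<le> 0" by linarith
  then obtain \<delta> where d: "\<delta> \<in> \<Delta>" "real (c \<delta>) * (\<delta> \<bullet> \<gamma>) > 0"
    using sum_nonpos[of \<Delta> "\<lambda>\<delta>. real (c \<delta>) * (\<delta> \<bullet> \<gamma>)"] not_less by blast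
  then have dg: "\<gamma> \<bullet> \<delta> > 0" by (simp add: zero_less_mult_iff inner_commute)
  have nz: "\<delta> \<noteq> 0" using root_nonzero simple_root d(1) by blast
  have s: "reflection \<delta> \<in> S" using d(1) by (simp add: simple_reflections_def)
  show ?case
  proof (cases "\<gamma> = \<delta>")
    case True
    then show ?thesis using simple_in[OF s] by simp
  next
    case False
    have "positive \<gamma>" using less.prems unfolding positive_def by blast
    then have "positive (reflection \<delta> \<gamma>)" using simple_reflection_positive[OF d(1) _ False] by blast
    then obtain c' :: "'a \<Rightarrow> nat" where r: "reflection \<delta> \<gamma> \<in> \<Phi>"
      and c': "reflection \<delta> \<gamma> = (\<Sum>\<delta>\<in>\<Delta>. real (c' \<delta>) *\<^sub>R \<delta>)"
      unfolding positive_def by blast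
    have cc: "real (c' \<epsilon>) = real (c \<epsilon>) - (if \<epsilon> = \<delta> then 2 * (\<gamma> \<bullet> \<delta>) / (\<delta> \<bullet> \<delta>) else 0)"
      if "\<epsilon> \<in> \<Delta>" for \<epsilon>
      by (rule coefficients_unique[OF _ that], subst c'[symmetric], subst (1) less.prems(2),
          subst reflection_coefficients[OF d(1)], subst less.prems(2)[symmetric], rule refl)
    have "2 * (\<gamma> \<bullet> \<delta>) / (\<delta> \<bullet> \<delta>) > 0" using dg nz by simp
    then have "c' \<epsilon> \<le> c \<epsilon>" "c' \<delta> < c \<delta>" if "\<epsilon> \<in> \<Delta>" for \<epsilon>
      using cc[OF that] cc[OF d(1)] by (auto split: if_splits)
    then have "(\<Sum>\<delta>\<in>\<Delta>. c' \<delta>) < (\<Sum>\<delta>\<in>\<Delta>. c \<delta>)"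
      using d(1) finite_base by (intro sum_strict_mono_ex1) auto
    from less.hyps[OF this r c'] have "reflection (reflection \<delta> \<gamma>) \<in> expressible S" .
    then have "reflection \<delta> \<circ> (reflection (reflection \<delta> \<gamma>) \<circ> reflection \<delta>) \<in> expressible S"
      using simple_in[OF s] comp_in by blast
    moreover have "reflection \<delta> \<circ> (reflection (reflection \<delta> \<gamma>) \<circ> reflection \<delta>) = reflection \<gamma>"
      by (simp add: fun_eq_iff reflection_conjugate[OF nz] reflection_reflection[OF nz])
    ultimately show ?thesis by metis
  qed
qed

lemma weyl_group_eq: "weyl_group \<Phi> = expressible S"
proof
  show "weyl_group \<Phi> \<subseteq> expressible S"
  proof
    fix w assume "w \<in> weyl_group \<Phi>"
    then show "w \<in> expressible S"
    proof induction
      case (comp \<alpha> w)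
      have "reflection \<alpha> \<in> expressible S"
        using positive_or_negative[OF comp(1)]
      proof
        assume "positive \<alpha>"
        then show ?thesis unfolding positive_def using reflection_expressible by blast
      next
        assume "positive (- \<alpha>)"
        then have "reflection (- \<alpha>) \<in> expressible S"
          unfolding positive_def using reflection_expressible by blast
        then show ?thesis by (simp only: reflection_uminus)
      qed
      then show ?case using comp comp_in by blast
    qed (rule id_in)
  qed
  show "expressible S \<subseteq> weyl_group \<Phi>"
  proof
    fix w assume "w \<in> expressible S"
    then obtain u where u: "set u \<subseteq> S" "w = word_prod u" unfolding expressible_def by blast
    have "word_prod u \<in> weyl_group \<Phi>"
      using u(1)
    proof (induction u)
      case Nil
      show ?case unfolding word_prod_Nil by (rule weyl_group.id)
    next
      case (Cons s u)
      then obtain \<delta> where "\<delta> \<in> \<Delta>" "s = reflection \<delta>" using simple_reflectionE by auto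
      then have "reflection \<delta> \<circ> word_prod u \<in> weyl_group \<Phi>"
        using weyl_group.comp[OF simple_root] Cons by auto
      then show ?case unfolding word_prod_Cons \<open>s = reflection \<delta>\<close> .
    qed
    then show "w \<in> weyl_group \<Phi>" using u(2) by simp
  qed
qed

end

section \<open>Operators on the functions on the group\<close>

text \<open>From here on composites are elements of a group and should not be unfolded to their values.\<close>

declare comp_apply [simp del] id_apply [simp del]

definition hecke_parameter :: laurent (\<open>\<zeta>\<close>) where
  "\<zeta> = laurent_var_inv - laurent_var"

definition basis_function :: "'b \<Rightarrow> 'b \<Rightarrow> laurent" where
  "basis_function x w = (if w = x then 1 else 0)"

context coxeter_group
begin

text \<open>A function \<open>f\<close> stands for the formal sum of the terms \<open>f w \<sqdot> h\<^sub>w\<close>, and \<open>left_mult s\<close> and \<open>right_mult t\<close> are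
the multiplications by \<open>h\<^sub>s\<close> and \<open>h\<^sub>t\<close>: the coefficient of \<open>h\<^sub>w\<close> in \<open>h\<^sub>s \<Sum> f(z) h\<^sub>z\<close> gets a
contribution from \<open>z = s w\<close> and, if \<open>s w\<close> is shorter than \<open>w\<close>, another one from \<open>z = w\<close>. The value
\<open>0\<close> outside \<open>W\<close> makes the operators commute as functions.\<close>

definition left_mult :: "('a \<Rightarrow> 'a) \<Rightarrow> (('a \<Rightarrow> 'a) \<Rightarrow> laurent) \<Rightarrow> ('a \<Rightarrow> 'a) \<Rightarrow> laurent" where
  "left_mult s f w =
     (if w \<in> W then f (s \<circ> w) + (if len (s \<circ> w) < len w then \<zeta> * f w else 0) else 0)"

definition right_mult :: "('a \<Rightarrow> 'a) \<Rightarrow> (('a \<Rightarrow> 'a) \<Rightarrow> laurent) \<Rightarrow> ('a \<Rightarrow> 'a) \<Rightarrow> laurent" where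
  "right_mult t f w =
     (if w \<in> W then f (w \<circ> t) + (if len (w \<circ> t) < len w then \<zeta> * f w else 0) else 0)"

primrec left_word :: "('a \<Rightarrow> 'a) list \<Rightarrow> (('a \<Rightarrow> 'a) \<Rightarrow> laurent) \<Rightarrow> ('a \<Rightarrow> 'a) \<Rightarrow> laurent" where
  "left_word [] f = f"
| "left_word (s # u) f = left_mult s (left_word u f)"

lemma left_word_append: "left_word (u @ v) f = left_word u (left_word v f)"
  by (induction u) simp_all

lemma left_mult_right_mult_commute:
  assumes s: "s \<in> S" and t: "t \<in> S"
  shows "left_mult s (right_mult t f) = right_mult t (left_mult s f)"
proof
  fix w
  show "left_mult s (right_mult t f) w = right_mult t (left_mult s f) w"
  proof (cases "w \<in> W")
    case True
    note w = True
    have sw: "s \<circ> w \<in> W" and wt: "w \<circ> t \<in> W"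
      using w simple_comp_in[OF s] comp_simple_in[OF t] by auto
    show ?thesis
    proof (cases "s \<circ> w = w \<circ> t")
      case True
      have "s \<circ> w \<circ> t = s \<circ> (w \<circ> t)" by (rule comp_assoc)
      then show ?thesis
        using w sw wt unfolding left_mult_def right_mult_def True by (auto simp: algebra_simps)
    next
      case False
      have d: "len (s \<circ> w \<circ> t) < len (w \<circ> t) \<longleftrightarrow> len (s \<circ> w) < len w"
        by (rule descent_comp_simple[OF s t w False])
      moreover have "len (s \<circ> w \<circ> t) = Suc (len (w \<circ> t)) \<or> len (w \<circ> t) = Suc (len (s \<circ> w \<circ> t))"
        using len_simple_comp[OF s wt] unfolding comp_assoc .
      ultimately have "len (s \<circ> w \<circ> t) < len (s \<circ> w) \<longleftrightarrow> len (w \<circ> t) < len w"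
        using len_simple_comp[OF s w] len_comp_simple[OF t w] by linarith
      then show ?thesis
        using w sw wt d unfolding left_mult_def right_mult_def comp_assoc
        by (auto simp: algebra_simps)
    qed
  qed (simp add: left_mult_def right_mult_def)
qed

lemma left_word_right_mult_commute:
  assumes "set u \<subseteq> S" "t \<in> S"
  shows "left_word u (right_mult t f) = right_mult t (left_word u f)"
  using assms(1)
proof (induction u)
  case (Cons s u)
  then show ?case using left_mult_right_mult_commute[OF _ assms(2)] by simp
qed simp

lemma left_mult_basis:
  assumes s: "s \<in> S" and w: "w \<in> W" and up: "len w < len (s \<circ> w)"
  shows "left_mult s (basis_function w) = basis_function (s \<circ> w)"
proof
  fix z
  have "s \<circ> z = w \<longleftrightarrow> z = s \<circ> w" using involution_comp[OF s] by metis
  then show "left_mult s (basis_function w) z = basis_function (s \<circ> w) z"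
    using up w simple_comp_in[OF s, of w] by (auto simp: left_mult_def basis_function_def)
qed

lemma right_mult_basis:
  assumes t: "t \<in> S" and w: "w \<in> W" and up: "len w < len (w \<circ> t)"
  shows "right_mult t (basis_function w) = basis_function (w \<circ> t)"
proof
  fix z
  have "z \<circ> t = w \<longleftrightarrow> z = w \<circ> t" using involution_comp_right[OF t] by metis
  then show "right_mult t (basis_function w) z = basis_function (w \<circ> t) z"
    using up w comp_simple_in[OF t, of w] by (auto simp: right_mult_def basis_function_def)
qed

lemma left_word_reduced:
  assumes "reduced u w"
  shows "left_word u (basis_function id) = basis_function w"
  using assms
proof (induction u arbitrary: w)
  case Nil
  then show ?case using reducedD(2)[OF Nil] by simp
next
  case (Cons s u)
  have u: "word_prod u \<in> W" using reduced_in[OF reduced_Cons(1)[OF Cons.prems]] .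
  have w: "w = s \<circ> word_prod u" and s: "s \<in> S" using reduced_Cons(3,4)[OF Cons.prems] by auto
  have "len (word_prod u) < len (s \<circ> word_prod u)"
    using reduced_Cons(2)[OF Cons.prems] unfolding w by (simp only: lessI)
  then show ?case
    using Cons.IH[OF reduced_Cons(1)[OF Cons.prems]] left_mult_basis[OF s u] w by simp
qed

text \<open>The operator of a reduced word depends only on the product of the word, without any use of braid
relations: it commutes with right multiplications, which produce all \<open>h\<^sub>w\<close> from \<open>h\<^sub>1\<close>, and on \<open>h\<^sub>1\<close> it
has the value given by \<open>left_word_reduced\<close>. The induction peels off right multiplications.\<close>

lemma left_word_basis_cong:
  assumes u: "reduced u x" and u': "reduced u' x" and w: "w \<in> W"
  shows "left_word u (basis_function w) = left_word u' (basis_function w)"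
  using w
proof (induction "len w" arbitrary: w rule: less_induct)
  case less
  obtain v where v: "reduced v w" using ex_reduced_expression[OF less.prems] by blast
  show ?case
  proof (cases v rule: rev_cases)
    case Nil
    then have "w = id" using reducedD(2)[OF v] by simp
    then show ?thesis using left_word_reduced[OF u] left_word_reduced[OF u'] by simp
  next
    case (snoc v' t)
    let ?y = "word_prod v'"
    have t: "t \<in> S" and v': "set v' \<subseteq> S" and w: "w = ?y \<circ> t" and l: "Suc (length v') = len w"
      using reducedD[OF v] snoc by auto
    have y: "?y \<in> W" using v' by blast
    have up: "len ?y < len (?y \<circ> t)"
      using expression_length_le[OF v'] l w by simp
    have e: "basis_function w = right_mult t (basis_function ?y)"
      using right_mult_basis[OF t y up] w by simp
    show ?thesis
      unfolding e left_word_right_mult_commute[OF reducedD(1)[OF u] t]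
        left_word_right_mult_commute[OF reducedD(1)[OF u'] t]
      using less.hyps[OF _ y] up w by simp
  qed
qed

lemma left_word_expand:
  assumes "\<And>w. w \<notin> W \<Longrightarrow> f w = 0"
  shows "left_word u f z = (\<Sum>w\<in>W. f w * left_word u (basis_function w) z)"
proof (induction u arbitrary: z)
  case Nil
  then show ?case
    using assms finite_group by (cases "z \<in> W") (auto simp: basis_function_def if_distrib cong: if_cong)
next
  case (Cons s u)
  show ?case
  proof (cases "z \<in> W")
    case True
    show ?thesis
    proof (cases "len (s \<circ> z) < len z")
      case less: True
      have "left_word (s # u) f z = left_word u f (s \<circ> z) + \<zeta> * left_word u f z"
        using True less by (simp add: left_mult_def)
      also have "\<dots> = (\<Sum>w\<in>W. f w * (left_word u (basis_function w) (s \<circ> z)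
          + \<zeta> * left_word u (basis_function w) z))"
        unfolding Cons.IH by (simp add: sum_distrib_left sum.distrib algebra_simps)
      also have "\<dots> = (\<Sum>w\<in>W. f w * left_word (s # u) (basis_function w) z)"
        using True less by (simp add: left_mult_def)
      finally show ?thesis .
    next
      case False
      then show ?thesis using True Cons.IH[of "s \<circ> z"] by (simp add: left_mult_def)
    qed
  qed (simp add: left_mult_def)
qed

lemma left_word_cong:
  assumes "reduced u x" "reduced u' x" "\<And>w. w \<notin> W \<Longrightarrow> f w = 0"
  shows "left_word u f = left_word u' f"
proof
  fix z
  show "left_word u f z = left_word u' f z"
    using left_word_basis_cong[OF assms(1,2)]
      left_word_expand[of f u z, OF assms(3)] left_word_expand[of f u' z, OF assms(3)]
    by (simp cong: sum.cong)
qed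

lemma left_mult_quadratic:
  assumes s: "s \<in> S" and f: "\<And>w. w \<notin> W \<Longrightarrow> f w = 0"
  shows "left_mult s (left_mult s f) w = \<zeta> * left_mult s f w + f w"
proof (cases "w \<in> W")
  case True
  have "s \<circ> (s \<circ> w) = w" by (rule involution_comp[OF s])
  moreover have "len (s \<circ> w) < len w \<longleftrightarrow> \<not> len w < len (s \<circ> w)"
    using len_simple_comp[OF s True] by linarith
  ultimately show ?thesis
    using True simple_comp_in[OF s, of w] by (auto simp: left_mult_def algebra_simps)
qed (simp add: left_mult_def f)

lemma left_word_support: "(\<And>w. w \<notin> W \<Longrightarrow> f w = 0) \<Longrightarrow> w \<notin> W \<Longrightarrow> left_word u f w = 0"
  by (cases u) (auto simp: left_mult_def)

end

section \<open>The Hecke algebra and its basis\<close>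

lemma poly_mapping_sum_single:
  "p = (\<Sum>k\<in>Poly_Mapping.keys p. Poly_Mapping.single k (Poly_Mapping.lookup p k))"
  by (rule poly_mapping_eqI)
    (simp add: lookup_sum lookup_single when_def in_keys_iff)

lemma poly_mapping_additive_induct [case_names single plus]:
  fixes p :: "'k \<Rightarrow>\<^sub>0 'c::comm_monoid_add"
  assumes single: "\<And>k a. P (Poly_Mapping.single k a)"
    and plus: "\<And>p q. P p \<Longrightarrow> P q \<Longrightarrow> P (p + q)"
  shows "P p"
proof -
  have "P (\<Sum>k\<in>A. Poly_Mapping.single k (Poly_Mapping.lookup p k))" if "finite A" for A
    using that by induction (use single plus single[of _ 0] in auto)
  from this[OF finite_keys[of p]] show ?thesis by (simp flip: poly_mapping_sum_single)
qed

lemma letters_plus [simp]: "letters (k + l) = letters k @ letters l"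
  by (simp add: plus_free_monoid_def)

lemma letters_zero [simp]: "letters 0 = []"
  by (simp add: zero_free_monoid_def)

lemma word_monomial_append: "word_monomial (u @ v) = word_monomial u * word_monomial v"
  by (simp add: word_monomial_def mult_single plus_free_monoid_def)

lemma word_monomial_Nil: "word_monomial [] = 1"
  by (simp add: word_monomial_def flip: zero_free_monoid_def)

lemma scalar_mult: "scalar (a * b) = scalar a * scalar b"
  by (simp add: scalar_def mult_single)

lemma scalar_plus: "scalar (a + b) = scalar a + scalar b"
  by (simp add: scalar_def single_add)

lemma scalar_zero [simp]: "scalar 0 = 0"
  by (simp add: scalar_def)

lemma scalar_one [simp]: "scalar 1 = 1"
  by (simp add: scalar_def)

lemma word_monomial_scalar: "word_monomial u * scalar a = scalar a * word_monomial u"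
  by (simp add: word_monomial_def scalar_def mult_single)

lemma free_algebra_on_uminus: "p \<in> free_algebra_on A \<Longrightarrow> - p \<in> free_algebra_on A"
  by (simp add: free_algebra_on_def)

lemma free_algebra_on_mult: "p \<in> free_algebra_on A \<Longrightarrow> q \<in> free_algebra_on A \<Longrightarrow> p * q \<in> free_algebra_on A"
  unfolding free_algebra_on_def using keys_mult[of p q] by fastforce

lemma scalar_free_algebra_on: "scalar a \<in> free_algebra_on A"
  by (simp add: free_algebra_on_def scalar_def)

lemma word_monomial_free_algebra_on: "set u \<subseteq> A \<Longrightarrow> word_monomial u \<in> free_algebra_on A"
  by (simp add: free_algebra_on_def word_monomial_def)

lemma one_free_algebra_on: "1 \<in> free_algebra_on A"
  by (simp add: free_algebra_on_def)

lemma hecke_relator_in_ideal: "r \<in> hecke_relators A \<Longrightarrow> r \<in> hecke_ideal A"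
  using hecke_ideal.add[OF hecke_ideal.zero one_free_algebra_on _ one_free_algebra_on] by fastforce

lemma hecke_ideal_plus:
  assumes "x \<in> hecke_ideal A" "y \<in> hecke_ideal A"
  shows "x + y \<in> hecke_ideal A"
  using assms(2)
proof induction
  case (add y p r q)
  then show ?case using hecke_ideal.add[OF add.IH add.hyps(2-4)] by (simp add: add.assoc)
qed (use assms(1) in simp)

lemma hecke_ideal_uminus: "x \<in> hecke_ideal A \<Longrightarrow> - x \<in> hecke_ideal A"
proof (induction rule: hecke_ideal.induct)
  case (add x p r q)
  then show ?case
    using hecke_ideal.add[OF add.IH free_algebra_on_uminus[OF add.hyps(2)] add.hyps(3,4)] by simp
qed (simp add: hecke_ideal.zero)

lemma hecke_ideal_mult:
  assumes "x \<in> hecke_ideal A" "a \<in> free_algebra_on A" "b \<in> free_algebra_on A"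
  shows "a * x * b \<in> hecke_ideal A"
  using assms(1)
proof induction
  case (add x p r q)
  have "a * (x + p * r * q) * b = a * x * b + (a * p) * r * (q * b)"
    by (simp add: algebra_simps)
  then show ?case
    using hecke_ideal.add[OF add.IH free_algebra_on_mult[OF assms(2) add.hyps(2)] add.hyps(3)
        free_algebra_on_mult[OF add.hyps(4) assms(3)]] by metis
qed (simp add: hecke_ideal.zero)

lemma hecke_eq_refl [simp]: "hecke_eq A p p"
  by (simp add: hecke_eq_def hecke_ideal.zero)

lemma hecke_eq_sym: "hecke_eq A p q \<Longrightarrow> hecke_eq A q p"
  unfolding hecke_eq_def using hecke_ideal_uminus by fastforce

lemma hecke_eq_trans [trans]: "hecke_eq A p q \<Longrightarrow> hecke_eq A q r \<Longrightarrow> hecke_eq A p r"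
  unfolding hecke_eq_def using hecke_ideal_plus[of "p - q" A "q - r"] by simp

lemma hecke_eq_plus: "hecke_eq A p q \<Longrightarrow> hecke_eq A p' q' \<Longrightarrow> hecke_eq A (p + p') (q + q')"
  unfolding hecke_eq_def using hecke_ideal_plus[of "p - q" A "p' - q'"] by (simp add: algebra_simps)

lemma hecke_eq_sum:
  "(\<And>i. i \<in> I \<Longrightarrow> hecke_eq A (p i) (q i)) \<Longrightarrow> hecke_eq A (\<Sum>i\<in>I. p i) (\<Sum>i\<in>I. q i)"
  by (induction I rule: infinite_finite_induct) (auto intro: hecke_eq_plus)

lemma hecke_eq_mult:
  assumes "hecke_eq A p q" "a \<in> free_algebra_on A" "b \<in> free_algebra_on A"
  shows "hecke_eq A (a * p * b) (a * q * b)"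
  using hecke_ideal_mult[of "p - q" A a b] assms by (simp add: hecke_eq_def algebra_simps)

lemma hecke_eq_mult_left: "hecke_eq A p q \<Longrightarrow> a \<in> free_algebra_on A \<Longrightarrow> hecke_eq A (a * p) (a * q)"
  using hecke_eq_mult[OF _ _ one_free_algebra_on, of A p q a] by simp

lemma hecke_eq_mult_right: "hecke_eq A p q \<Longrightarrow> b \<in> free_algebra_on A \<Longrightarrow> hecke_eq A (p * b) (q * b)"
  using hecke_eq_mult[OF _ one_free_algebra_on, of A p q b] by simp

lemma hecke_eq_relator: "p - q \<in> hecke_relators A \<Longrightarrow> hecke_eq A p q"
  by (simp add: hecke_eq_def hecke_relator_in_ideal)

lemma hecke_eq_braid_moves: "(braid_move A)\<^sup>*\<^sup>* u u' \<Longrightarrow> hecke_eq A (word_monomial u) (word_monomial u')"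
proof (induction rule: rtranclp_induct)
  case (step y z)
  then obtain a b s t where ab: "set a \<subseteq> A" "set b \<subseteq> A" "s \<in> A" "t \<in> A" "s \<noteq> t"
    and y: "y = a @ alternating (transformation_order (s \<circ> t)) s t @ b"
    and z: "z = a @ alternating (transformation_order (s \<circ> t)) t s @ b"
    unfolding braid_move_def by blast
  have "word_monomial (alternating (transformation_order (s \<circ> t)) s t)
        - word_monomial (alternating (transformation_order (s \<circ> t)) t s) \<in> hecke_relators A"
    unfolding hecke_relators_def using ab by blast
  from hecke_eq_mult[OF hecke_eq_relator[OF this] word_monomial_free_algebra_on[OF ab(1)]
      word_monomial_free_algebra_on[OF ab(2)]]
  have "hecke_eq A (word_monomial y) (word_monomial z)"
    by (simp add: y z word_monomial_append mult.assoc)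
  then show ?case using step.IH hecke_eq_trans by blast
qed simp

context coxeter_group
begin

lemma reduced_some: "w \<in> W \<Longrightarrow> reduced (SOME u. reduced u w) w"
  using ex_reduced_expression by (rule someI_ex)

lemma hecke_basis_reduced:
  assumes "reduced u w"
  shows "hecke_eq S (word_monomial u) (hecke_basis S w)"
  unfolding hecke_basis_def
  by (rule hecke_eq_braid_moves[OF matsumoto[OF assms reduced_some[OF reduced_in[OF assms]]]])

lemma simple_mult_hecke_basis:
  assumes s: "s \<in> S" and w: "w \<in> W"
  shows "hecke_eq S (word_monomial [s] * hecke_basis S w)
    (hecke_basis S (s \<circ> w) + (if len (s \<circ> w) < len w then scalar \<zeta> * hecke_basis S w else 0))"
proof -
  have sA: "word_monomial [s] \<in> free_algebra_on S"
    using s by (simp add: word_monomial_free_algebra_on)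
  show ?thesis
  proof (cases "len (s \<circ> w) < len w")
    case False
    then have l: "len (s \<circ> w) = Suc (len w)" using len_simple_comp[OF s w] by linarith
    obtain u where u: "reduced u w" using ex_reduced_expression[OF w] by blast
    have "word_prod (s # u) = s \<circ> w" using reducedD(2)[OF u] by (simp only: word_prod_Cons)
    then have su: "reduced (s # u) (s \<circ> w)"
      unfolding reduced_expression_iff l using reducedD[OF u] s by simp
    have "hecke_eq S (word_monomial [s] * hecke_basis S w) (word_monomial [s] * word_monomial u)"
      by (rule hecke_eq_mult_left[OF hecke_eq_sym[OF hecke_basis_reduced[OF u]] sA])
    also have "word_monomial [s] * word_monomial u = word_monomial (s # u)"
      by (simp flip: word_monomial_append)
    also have "hecke_eq S \<dots> (hecke_basis S (s \<circ> w))" by (rule hecke_basis_reduced[OF su])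
    finally show ?thesis using False by simp
  next
    case True
    let ?y = "s \<circ> w"
    have y: "?y \<in> W" and sy: "s \<circ> ?y = w" using simple_comp_in[OF s] w involution_comp[OF s] by auto
    have l: "len w = Suc (len ?y)" using len_simple_comp[OF s w] True by linarith
    obtain u where u: "reduced u ?y" using ex_reduced_expression[OF y] by blast
    have "word_prod (s # u) = w" using reducedD(2)[OF u] sy by (simp only: word_prod_Cons)
    then have su: "reduced (s # u) w"
      unfolding reduced_expression_iff l using reducedD[OF u] s by simp
    have uA: "word_monomial u \<in> free_algebra_on S"
      using reducedD(1)[OF u] by (rule word_monomial_free_algebra_on)
    have "word_monomial [s] * word_monomial [s] - (scalar \<zeta> * word_monomial [s] + 1) \<in> hecke_relators S"
      unfolding hecke_relators_def hecke_parameter_def using s by blast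
    note quadratic = hecke_eq_mult_right[OF hecke_eq_relator[OF this] uA]
    have "hecke_eq S (word_monomial [s] * hecke_basis S w) (word_monomial [s] * word_monomial (s # u))"
      by (rule hecke_eq_mult_left[OF hecke_eq_sym[OF hecke_basis_reduced[OF su]] sA])
    also have "word_monomial [s] * word_monomial (s # u) = word_monomial [s] * word_monomial [s] * word_monomial u"
      using word_monomial_append[of "[s]" u] by (simp add: mult.assoc)
    also note quadratic
    also have "(scalar \<zeta> * word_monomial [s] + 1) * word_monomial u =
        word_monomial u + scalar \<zeta> * word_monomial (s # u)"
      using word_monomial_append[of "[s]" u] by (simp add: algebra_simps)
    also have "hecke_eq S \<dots> (hecke_basis S ?y + scalar \<zeta> * hecke_basis S w)"
      by (intro hecke_eq_plus hecke_eq_mult_left hecke_basis_reduced u su scalar_free_algebra_on)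
    finally show ?thesis using True by simp
  qed
qed

text \<open>Multiplication by a word in the quotient is computed by the operators on coefficient functions.
In particular the \<open>h\<^sub>w\<close> span the Hecke algebra.\<close>

lemma word_mult_hecke_basis:
  assumes "set u \<subseteq> S" "y \<in> W"
  shows "hecke_eq S (word_monomial u * hecke_basis S y)
    (\<Sum>z\<in>W. scalar (left_word u (basis_function y) z) * hecke_basis S z)"
  using assms(1)
proof (induction u)
  case Nil
  have "(\<Sum>z\<in>W. scalar (left_word [] (basis_function y) z) * hecke_basis S z) =
      (\<Sum>z\<in>W. if z = y then hecke_basis S y else 0)"
    by (intro sum.cong) (auto simp: basis_function_def)
  also have "\<dots> = hecke_basis S y" using assms(2) finite_group by simp
  finally show ?case by (simp add: word_monomial_Nil)
next
  case (Cons s u)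
  let ?g = "left_word u (basis_function y)"
  have s: "s \<in> S" and u: "set u \<subseteq> S" using Cons.prems by auto
  have sA: "word_monomial [s] \<in> free_algebra_on S"
    using s by (simp add: word_monomial_free_algebra_on)
  have "word_monomial (s # u) * hecke_basis S y = word_monomial [s] * (word_monomial u * hecke_basis S y)"
    using word_monomial_append[of "[s]" u] by (simp add: mult.assoc)
  also have "hecke_eq S \<dots> (word_monomial [s] * (\<Sum>z\<in>W. scalar (?g z) * hecke_basis S z))"
    by (rule hecke_eq_mult_left[OF Cons.IH[OF u] sA])
  also have "word_monomial [s] * (\<Sum>z\<in>W. scalar (?g z) * hecke_basis S z) =
      (\<Sum>z\<in>W. scalar (?g z) * (word_monomial [s] * hecke_basis S z))"
    by (simp add: sum_distrib_left word_monomial_scalar flip: mult.assoc)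
  also have "hecke_eq S \<dots> (\<Sum>z\<in>W. scalar (?g z) *
      (hecke_basis S (s \<circ> z) + (if len (s \<circ> z) < len z then scalar \<zeta> * hecke_basis S z else 0)))"
    by (intro hecke_eq_sum hecke_eq_mult_left simple_mult_hecke_basis s scalar_free_algebra_on)
  also have "\<dots> = (\<Sum>z\<in>W. scalar (?g z) * hecke_basis S (s \<circ> z)) +
      (\<Sum>z\<in>W. scalar (if len (s \<circ> z) < len z then \<zeta> * ?g z else 0) * hecke_basis S z)"
    by (simp add: algebra_simps scalar_mult flip: sum.distrib cong: sum.cong if_cong)
      (auto intro!: sum.cong simp: algebra_simps mult.commute simp flip: scalar_mult mult.assoc)
  \<comment> \<open>Substituting \<open>s \<circ> z\<close> for \<open>z\<close> turns the two sums into the two summands of \<open>left_mult\<close>.\<close>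
  also have "(\<Sum>z\<in>W. scalar (?g z) * hecke_basis S (s \<circ> z)) =
      (\<Sum>z\<in>W. scalar (?g (s \<circ> z)) * hecke_basis S z)"
    by (rule sum.reindex_bij_witness[of _ "\<lambda>z. s \<circ> z" "\<lambda>z. s \<circ> z"])
      (simp_all add: involution_comp[OF s] simple_comp_in[OF s])
  also have "\<dots> + (\<Sum>z\<in>W. scalar (if len (s \<circ> z) < len z then \<zeta> * ?g z else 0) * hecke_basis S z) =
      (\<Sum>z\<in>W. scalar (left_word (s # u) (basis_function y) z) * hecke_basis S z)"
    unfolding sum.distrib[symmetric]
    by (intro sum.cong) (simp_all add: left_mult_def scalar_plus algebra_simps)
  finally show ?case .
qed

definition act :: "('a \<Rightarrow> 'a) free_algebra \<Rightarrow> (('a \<Rightarrow> 'a) \<Rightarrow> laurent) \<Rightarrow> ('a \<Rightarrow> 'a) \<Rightarrow> laurent" where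
  "act p f w = (\<Sum>k\<in>Poly_Mapping.keys p. Poly_Mapping.lookup p k * left_word (letters k) f w)"

lemma act_plus: "act (p + q) f w = act p f w + act q f w"
  unfolding act_def by (rule setsum_keys_plus_distrib) (simp_all add: algebra_simps)

lemma act_single: "act (Poly_Mapping.single k a) f w = a * left_word (letters k) f w"
  by (simp add: act_def)

lemma act_zero [simp]: "act 0 f w = 0"
  by (simp add: act_def)

lemma act_uminus: "act (- p) f w = - act p f w"
  using act_plus[of p "- p" f w] by (simp add: add_eq_0_iff2)

lemma act_diff: "act (p - q) f w = act p f w - act q f w"
  using act_plus[of p "- q" f w] by (simp add: act_uminus)

lemma left_word_linear:
  "left_word u (\<lambda>w. f w + g w) w = left_word u f w + left_word u g w"
  "left_word u (\<lambda>w. a * f w) w = a * left_word u f w"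
  by (induction u arbitrary: w) (simp_all add: left_mult_def algebra_simps)

lemma act_linear:
  "act p (\<lambda>w. f w + g w) w = act p f w + act p g w"
  "act p (\<lambda>w. a * f w) w = a * act p f w"
  by (simp_all add: act_def left_word_linear algebra_simps sum.distrib sum_distrib_left)

lemma act_mult: "act (p * q) f w = act p (act q f) w"
proof (induction p arbitrary: w rule: poly_mapping_additive_induct)
  case (single k a)
  show ?case
  proof (induction q arbitrary: w rule: poly_mapping_additive_induct)
    case (single l b)
    have "act (Poly_Mapping.single l b) f = (\<lambda>w. b * left_word (letters l) f w)"
      by (simp add: act_single fun_eq_iff)
    then show ?case by (simp add: mult_single act_single left_word_linear left_word_append mult.assoc)
  next
    case (plus p q)
    have "act (p + q) f = (\<lambda>w. act p f w + act q f w)" by (simp add: act_plus fun_eq_iff)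
    then show ?case using plus by (simp add: distrib_left act_plus act_linear)
  qed
qed (simp add: distrib_right act_plus)

lemma act_support:
  "(\<And>w. w \<notin> W \<Longrightarrow> f w = 0) \<Longrightarrow> w \<notin> W \<Longrightarrow> act p f w = 0"
  unfolding act_def by (simp add: left_word_support)

lemma act_word_monomial: "act (word_monomial u) f w = left_word u f w"
  by (simp add: word_monomial_def act_single)

lemma act_scalar: "act (scalar a) f w = a * f w"
  by (simp add: scalar_def act_single)

lemma act_one: "act 1 f w = f w"
  using act_scalar[of 1] by simp

text \<open>Both alternating words in a braid relator are reduced with the same product, so they have the
same operator.\<close>

lemma act_relator:
  assumes r: "r \<in> hecke_relators S" and f: "\<And>w. w \<notin> W \<Longrightarrow> f w = 0"
  shows "act r f w = 0"
proof -
  consider s where "s \<in> S" "r = word_monomial [s] * word_monomial [s]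
        - (scalar (laurent_var_inv - laurent_var) * word_monomial [s] + 1)"
    | s t where "s \<in> S" "t \<in> S" "s \<noteq> t"
      "r = word_monomial (alternating (transformation_order (s \<circ> t)) s t)
        - word_monomial (alternating (transformation_order (s \<circ> t)) t s)"
    using r unfolding hecke_relators_def by blast
  then show ?thesis
  proof cases
    case 1
    have "act (word_monomial [s]) f = left_mult s f"
      by (simp add: act_word_monomial fun_eq_iff)
    then show ?thesis
      using left_mult_quadratic[OF 1(1), of f w] f unfolding 1(2)
      by (simp add: act_diff act_plus act_mult act_word_monomial act_scalar act_one
          flip: hecke_parameter_def)
  next
    case 2
    let ?m = "transformation_order (s \<circ> t)"
    have sub: "set (alternating ?m s t) \<subseteq> S" "set (alternating ?m t s) \<subseteq> S"
      using set_alternating[of ?m s t] set_alternating[of ?m t s] 2(1,2) by auto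
    have m: "(s \<circ> t) ^^ ?m = id"
      by (rule transformation_order[OF comp_in[OF simple_in[OF 2(1)] simple_in[OF 2(2)]]])
    have "reduced (alternating ?m s t) (word_prod (alternating ?m s t))"
      "reduced (alternating ?m t s) (word_prod (alternating ?m s t))"
      using sub len_alternating[OF 2(1-3) order_refl] m alternating_eq_iff[OF 2(1,2), of ?m]
      by (auto simp: reduced_expression_iff)
    from left_word_cong[OF this f] show ?thesis
      unfolding 2(4) by (simp add: act_diff act_word_monomial)
  qed
qed

lemma act_ideal:
  assumes p: "p \<in> hecke_ideal S" and f: "\<And>w. w \<notin> W \<Longrightarrow> f w = 0"
  shows "act p f w = 0"
  using p
proof (induction arbitrary: w)
  case (add x p r q)
  have "act r (act q f) = (\<lambda>w. 0 * f w)"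
    using act_relator[OF add.hyps(3), of "act q f"] act_support[of f] f by (simp add: fun_eq_iff)
  then have "act (p * r * q) f w = 0"
    using act_linear(2)[of p 0 f w] by (simp add: act_mult)
  then show ?case using add.IH by (simp add: act_plus)
qed simp

text \<open>Both sides act in the same way on the indicator of the identity, which each \<open>h\<^sub>w\<close> sends to the
indicator of \<open>w\<close>; so the coefficients can be read off.\<close>

lemma hecke_basis_independent:
  assumes eq: "hecke_eq S (\<Sum>z\<in>W. scalar (c z) * hecke_basis S z) (\<Sum>z\<in>W. scalar (d z) * hecke_basis S z)"
    and z: "z \<in> W"
  shows "c z = d z"
proof -
  let ?e = "basis_function id"
  have e: "?e w = 0" if "w \<notin> W" for w
    using that id_in by (auto simp: basis_function_def)
  have b: "act (hecke_basis S w) ?e = basis_function w" if "w \<in> W" for w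
    unfolding hecke_basis_def
    using left_word_reduced[OF reduced_some[OF that]] by (simp add: act_word_monomial fun_eq_iff)
  have s: "act (\<Sum>w\<in>A. p w) ?e z = (\<Sum>w\<in>A. act (p w) ?e z)" for A :: "('a \<Rightarrow> 'a) set" and p
    by (induction A rule: infinite_finite_induct) (simp_all add: act_plus)
  have "act (\<Sum>w\<in>W. scalar (c w) * hecke_basis S w) ?e z = c z" for c
  proof -
    have "act (\<Sum>w\<in>W. scalar (c w) * hecke_basis S w) ?e z = (\<Sum>w\<in>W. if w = z then c z else 0)"
      unfolding s by (intro sum.cong) (auto simp: act_mult act_scalar b basis_function_def)
    then show ?thesis using z finite_group by simp
  qed
  then show ?thesis
    using act_ideal[of _ ?e, OF eq[unfolded hecke_eq_def] e, of z] by (simp add: act_diff)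
qed

text \<open>The definite description is resolved: \<open>word_mult_hecke_basis\<close> gives existence and
\<open>hecke_basis_independent\<close> uniqueness.\<close>

lemma structure_constant_eq:
  assumes x: "x \<in> W" and y: "y \<in> W"
  shows "structure_constant W S x y =
    (\<lambda>z. if z \<in> W then left_word (SOME u. reduced u x) (basis_function y) (inv z) else 0)"
    (is "_ = ?c")
proof -
  have reindex: "(\<Sum>z\<in>W. scalar (c z) * hecke_basis S (inv z)) =
      (\<Sum>z\<in>W. scalar (c (inv z)) * hecke_basis S z)" for c
    by (rule sum.reindex_bij_witness[of _ inv inv]) (simp_all add: inv_in inv_inv_W)
  have red: "reduced (SOME u. reduced u x) x" by (rule reduced_some[OF x])
  have expand: "hecke_eq S (hecke_basis S x * hecke_basis S y)
      (\<Sum>z\<in>W. scalar (left_word (SOME u. reduced u x) (basis_function y) z) * hecke_basis S z)"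
    using word_mult_hecke_basis[OF reducedD(1)[OF red] y] unfolding hecke_basis_def .
  show ?thesis
    unfolding structure_constant_def
  proof (rule the_equality, intro conjI allI impI)
    show "hecke_eq S (hecke_basis S x * hecke_basis S y) (\<Sum>z\<in>W. scalar (?c z) * hecke_basis S (inv z))"
      using expand unfolding reindex by (simp add: inv_in inv_inv_W cong: sum.cong)
  next
    fix c assume c: "(\<forall>z. z \<notin> W \<longrightarrow> c z = 0) \<and> hecke_eq S (hecke_basis S x * hecke_basis S y)
        (\<Sum>z\<in>W. scalar (c z) * hecke_basis S (inv z))"
    then have "hecke_eq S (\<Sum>z\<in>W. scalar (c (inv z)) * hecke_basis S z)
        (\<Sum>z\<in>W. scalar (left_word (SOME u. reduced u x) (basis_function y) z) * hecke_basis S z)"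
      using expand hecke_eq_sym hecke_eq_trans unfolding reindex by blast
    from hecke_basis_independent[OF this inv_in] show "c = ?c"
      using c by (auto simp: fun_eq_iff inv_inv_W)
  qed simp
qed

end

section \<open>Parity of structure constants and labelings\<close>

lemma laurent_subst_single: "laurent_subst m (Poly_Mapping.single k a) = Poly_Mapping.single (m * k) a"
  by (simp add: laurent_subst_def)

lemma laurent_subst_plus: "laurent_subst m (p + q) = laurent_subst m p + laurent_subst m q"
  unfolding laurent_subst_def by (rule setsum_keys_plus_distrib) (simp_all add: single_add)

lemma laurent_subst_mult: "laurent_subst m (p * q) = laurent_subst m p * laurent_subst m q"
proof (induction p rule: poly_mapping_additive_induct)
  case (single k a)
  show ?case
    by (induction q rule: poly_mapping_additive_induct)
      (simp_all add: mult_single laurent_subst_single laurent_subst_plus algebra_simps)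
qed (simp add: laurent_subst_plus algebra_simps)

text \<open>With \<open>q = v\<^sup>-\<^sup>2\<close>, these are the Laurent polynomials in \<open>q\<close> that are invariant under \<open>q \<mapsto> q\<^sup>-\<^sup>1\<close>.\<close>

definition symmetric_in_q :: "laurent set" where
  "symmetric_in_q = {laurent_subst (-2) Q | Q. laurent_subst (-1) Q = Q}"

lemma symmetric_in_q_zero: "0 \<in> symmetric_in_q"
  using laurent_subst_single[of _ 0 0] unfolding symmetric_in_q_def by force

lemma symmetric_in_q_one: "1 \<in> symmetric_in_q"
  using laurent_subst_single[of _ 0 1] unfolding symmetric_in_q_def by force

lemma symmetric_in_q_plus: "p \<in> symmetric_in_q \<Longrightarrow> q \<in> symmetric_in_q \<Longrightarrow> p + q \<in> symmetric_in_q"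
  unfolding symmetric_in_q_def mem_Collect_eq by (metis laurent_subst_plus)

lemma symmetric_in_q_sum: "(\<And>i. i \<in> I \<Longrightarrow> p i \<in> symmetric_in_q) \<Longrightarrow> (\<Sum>i\<in>I. p i) \<in> symmetric_in_q"
  by (induction I rule: infinite_finite_induct)
    (auto intro: symmetric_in_q_plus symmetric_in_q_zero)

lemma symmetric_in_q_mult: "p \<in> symmetric_in_q \<Longrightarrow> q \<in> symmetric_in_q \<Longrightarrow> p * q \<in> symmetric_in_q"
  unfolding symmetric_in_q_def mem_Collect_eq by (metis laurent_subst_mult)

text \<open>The witness is \<open>q + q\<^sup>-\<^sup>1 - 2\<close>; the constant term is split in two halves so that the inversion of the
variable exchanges the two summands.\<close>

lemma hecke_parameter_square: "\<zeta> * \<zeta> \<in> symmetric_in_q"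
proof -
  let ?Q = "(Poly_Mapping.single 1 1 + Poly_Mapping.single 0 (-1))
    + (Poly_Mapping.single (-1) 1 + Poly_Mapping.single 0 (-1)) :: laurent"
  have "laurent_subst (-1) ?Q = ?Q"
    unfolding laurent_subst_plus laurent_subst_single by (simp add: add.commute)
  moreover have "\<zeta> * \<zeta> = laurent_subst (-2) ?Q"
    unfolding laurent_subst_plus laurent_subst_single
    by (simp add: hecke_parameter_def laurent_var_def laurent_var_inv_def algebra_simps
        mult_single single_uminus)
  ultimately show ?thesis unfolding symmetric_in_q_def by blast
qed

text \<open>A grading modulo \<open>2\<close> with \<open>\<zeta>\<close> odd. The index is a natural number, of which only the parity matters,
so that lengths can be used as degrees directly.\<close>

definition parity_part :: "nat \<Rightarrow> laurent set" where
  "parity_part n = (if even n then symmetric_in_q else {\<zeta> * p | p. p \<in> symmetric_in_q})"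

lemma parity_part_zero: "0 \<in> parity_part n"
  using symmetric_in_q_zero by (force simp: parity_part_def)

lemma parity_part_plus:
  assumes p: "p \<in> parity_part n" and q: "q \<in> parity_part n"
  shows "p + q \<in> parity_part n"
proof (cases "even n")
  case True
  then show ?thesis using p q symmetric_in_q_plus by (simp add: parity_part_def)
next
  case False
  then obtain p' q' where "p' \<in> symmetric_in_q" "p = \<zeta> * p'" "q' \<in> symmetric_in_q" "q = \<zeta> * q'"
    using p q by (auto simp: parity_part_def)
  then have "p + q = \<zeta> * (p' + q')" "p' + q' \<in> symmetric_in_q"
    using symmetric_in_q_plus by (simp_all add: distrib_left)
  then show ?thesis using False unfolding parity_part_def by auto
qed

lemma parity_part_mult:
  assumes p: "p \<in> parity_part m" and q: "q \<in> parity_part n"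
  shows "p * q \<in> parity_part (m + n)"
proof -
  obtain p' where p': "p' \<in> symmetric_in_q" "p = (if even m then p' else \<zeta> * p')"
    using p by (auto simp: parity_part_def split: if_splits)
  obtain q' where q': "q' \<in> symmetric_in_q" "q = (if even n then q' else \<zeta> * q')"
    using q by (auto simp: parity_part_def split: if_splits)
  have pq: "p' * q' \<in> symmetric_in_q" by (rule symmetric_in_q_mult[OF p'(1) q'(1)])
  have "\<zeta> * p' * (\<zeta> * q') = \<zeta> * \<zeta> * (p' * q')" by (simp add: algebra_simps)
  then have "\<zeta> * p' * (\<zeta> * q') \<in> symmetric_in_q"
    using symmetric_in_q_mult[OF hecke_parameter_square pq] by (simp only:)
  moreover have "p' * (\<zeta> * q') = \<zeta> * (p' * q')" "\<zeta> * p' * q' = \<zeta> * (p' * q')"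
    by (simp_all add: algebra_simps)
  ultimately show ?thesis using pq p'(2) q'(2) unfolding parity_part_def by auto
qed

lemma parity_part_prod:
  assumes "\<And>i. i \<in> I \<Longrightarrow> p i \<in> parity_part (n i)"
  shows "(\<Prod>i\<in>I. p i) \<in> parity_part (\<Sum>i\<in>I. n i)"
proof -
  have "1 \<in> parity_part 0" by (simp add: parity_part_def symmetric_in_q_one)
  then show ?thesis
    using assms by (induction I rule: infinite_finite_induct) (simp_all add: parity_part_mult)
qed

lemma even_sum_involution:
  fixes h :: "'b \<Rightarrow> nat"
  assumes A: "finite A" and g: "\<And>x. x \<in> A \<Longrightarrow> g x \<in> A \<and> g x \<noteq> x \<and> g (g x) = x"
    and h: "\<And>x. x \<in> A \<Longrightarrow> h (g x) = h x"
  shows "even (\<Sum>x\<in>A. h x)"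
proof -
  have "(\<Sum>x\<in>A. h x) = (\<Sum>e\<in>(\<lambda>x. {x, g x}) ` A. \<Sum>x | x \<in> A \<and> {x, g x} = e. h x)"
    by (rule sum.image_gen[OF A])
  moreover have "even (\<Sum>x | x \<in> A \<and> {x, g x} = e. h x)" if "e \<in> (\<lambda>x. {x, g x}) ` A" for e
  proof -
    obtain y where y: "y \<in> A" "e = {y, g y}" using \<open>e \<in> _\<close> by blast
    have "{x. x \<in> A \<and> {x, g x} = e} = {y, g y}"
      unfolding y(2) using g[OF y(1)] y(1) by (auto simp: doubleton_eq_iff)
    moreover have "(\<Sum>x\<in>{y, g y}. h x) = h y + h y"
      using g[OF y(1)] h[OF y(1)] by (subst sum.insert) (auto simp: id_apply)
    ultimately show ?thesis by simp
  qed
  ultimately show ?thesis by (simp add: dvd_sum)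
qed

context coxeter_group
begin

text \<open>Passing from \<open>z\<close> to \<open>s \<circ> z\<close> changes the parity of the length, and the other summand of \<open>left_mult\<close>
contributes a factor \<open>\<zeta>\<close>; so each letter shifts the degree by one.\<close>

lemma left_word_parity:
  assumes "set u \<subseteq> S" "z \<in> W"
  shows "left_word u (basis_function y) z \<in> parity_part (length u + len y + len z)"
  using assms
proof (induction u arbitrary: z)
  case Nil
  then show ?case by (auto simp: basis_function_def parity_part_zero) (simp add: parity_part_def symmetric_in_q_one)
next
  case (Cons s u)
  let ?g = "left_word u (basis_function y)"
  have s: "s \<in> S" and u: "set u \<subseteq> S" using Cons.prems by auto
  have sz: "s \<circ> z \<in> W" using simple_comp_in[OF s] Cons.prems by simp
  have "\<zeta> \<in> parity_part 1" using symmetric_in_q_one by (force simp: parity_part_def)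
  from parity_part_mult[OF this Cons.IH[OF u Cons.prems(2)]]
  have "\<zeta> * ?g z \<in> parity_part (length (s # u) + len y + len z)" by simp
  moreover have "?g (s \<circ> z) \<in> parity_part (length (s # u) + len y + len z)"
  proof -
    have "even (length u + len y + len (s \<circ> z)) \<longleftrightarrow> even (length (s # u) + len y + len z)"
      using len_simple_comp[OF s Cons.prems(2)] by auto
    then show ?thesis using Cons.IH[OF u sz] unfolding parity_part_def by simp
  qed
  ultimately show ?case
    using Cons.prems(2) by (simp add: left_mult_def parity_part_plus)
qed

lemma structure_constant_parity:
  assumes "x \<in> W" "y \<in> W" "z \<in> W"
  shows "structure_constant W S x y z \<in> parity_part (len x + len y + len z)"
  using left_word_parity[OF reducedD(1)[OF reduced_some[OF assms(1)]] inv_in[OF assms(3)]]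
    reducedD(3)[OF reduced_some[OF assms(1)]] assms
  by (simp add: structure_constant_eq len_inv)

text \<open>Each summand has as its degree the sum of the lengths of all side labels. The two sides of an edge
carry labels of equal length, so this sum is even.\<close>

theorem surface_invariant_symmetric:
  assumes F: "finite F"
    and glue: "\<And>s. s \<in> sides F \<Longrightarrow> glue s \<in> sides F \<and> glue s \<noteq> s \<and> glue (glue s) = s"
  shows "surface_invariant W S F glue ori \<in> symmetric_in_q"
proof -
  have "(\<Prod>f\<in>F. structure_constant W S (side_label glue ori l (f, 0))
      (side_label glue ori l (f, 1)) (side_label glue ori l (f, 2))) \<in> symmetric_in_q"
    if l: "l \<in> edges F glue \<rightarrow>\<^sub>E W" for l
  proof -
    let ?lab = "side_label glue ori l"
    have lW: "l (side_edge glue s) \<in> W" if "s \<in> sides F" for s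
      using l that by (auto simp: edges_def)
    have lab: "?lab s \<in> W" "len (?lab s) = len (l (side_edge glue s))" if "s \<in> sides F" for s
      using lW[OF that] by (auto simp: side_label_def inv_in len_inv)
    have side: "(f, i) \<in> sides F" if "f \<in> F" "i < 3" for f i
      using that by (simp add: sides_def)
    have "(\<Prod>f\<in>F. structure_constant W S (?lab (f, 0)) (?lab (f, 1)) (?lab (f, 2))) \<in>
        parity_part (\<Sum>f\<in>F. len (?lab (f, 0)) + len (?lab (f, 1)) + len (?lab (f, 2)))"
      by (intro parity_part_prod structure_constant_parity lab side) simp_all
    moreover have "(\<Sum>f\<in>F. len (?lab (f, 0)) + len (?lab (f, 1)) + len (?lab (f, 2))) =
        (\<Sum>f\<in>F. \<Sum>i<3. len (?lab (f, i)))"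
      by (simp add: numeral_3_eq_3 numeral_2_eq_2)
    moreover have "\<dots> = (\<Sum>s\<in>sides F. len (?lab s))"
      by (simp add: sides_def sum.cartesian_product)
    moreover have "\<dots> = (\<Sum>s\<in>sides F. len (l (side_edge glue s)))"
      by (intro sum.cong lab) simp_all
    moreover have "even \<dots>"
    proof (rule even_sum_involution[OF _ glue])
      show "finite (sides F)" using F by (simp add: sides_def)
      show "len (l (side_edge glue (glue s))) = len (l (side_edge glue s))" if "s \<in> sides F" for s
        using glue[OF that] by (simp add: side_edge_def insert_commute)
    qed
    ultimately show ?thesis unfolding parity_part_def by simp
  qed
  then show ?thesis
    unfolding surface_invariant_def
    by (rule symmetric_in_q_sum)
qed

end

theorem corollary3:
  fixes \<Phi> \<Delta> :: "'a::euclidean_space set"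
    and g k :: nat
    and F :: "'f set"
    and glue :: "'f \<times> nat \<Rightarrow> 'f \<times> nat"
    and ori :: "('f \<times> nat) set \<Rightarrow> 'f \<times> nat"
  assumes "root_system \<Phi>" and "root_base \<Phi> \<Delta>"
    and "k \<ge> 1" and "g = 0 \<Longrightarrow> k \<ge> 3"
    and "ideal_triangulation g k F glue" and "edge_orientation F glue ori"
  shows "\<exists>Q :: laurent.
    surface_invariant (weyl_group \<Phi>) (simple_reflections \<Delta>) F glue ori = laurent_subst (-2) Q \<and>
    laurent_subst (-1) Q = Q"
proof -
  interpret based_root_system \<Phi> \<Delta>
    using assms(1,2) by unfold_locales
  have "surface_invariant (weyl_group \<Phi>) (simple_reflections \<Delta>) F glue ori \<in> symmetric_in_q"
    unfolding weyl_group_eq using assms(5)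
    by (intro surface_invariant_symmetric) (auto simp: ideal_triangulation_def)
  then show ?thesis unfolding symmetric_in_q_def by blast
qed

end
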